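(* Let $\mathcal{P}\subset\mathbb{C}^r$ be open and simply connected, let $\mathcal{D}\subset\mathbb{P}^1(\mathbb{C})$ be open such that $\mathbb{P}^1(\mathbb{C})\setminus\mathcal{D}$ is the union of $m$ disjoint closed disks $D_1,\dots,D_m$, and let $x_0\in\mathcal{D}$. Let $A_i:\mathcal{P}\to\mathfrak{gl}_n(\mathbb{C})$ and $x_i:\mathcal{P}\to\mathbb{C}$ ($i=1,\dots,m$) be analytic functions with $x_i(t)\in D_i$ for all $t\in\mathcal{P}$, such that the equation $$\frac{dY}{dx}=\sum_{i=1}^m\frac{A_i(t)}{x-x_i(t)}\,Y\qquad(\ast)$$ is analytic on $\mathcal{D}\times\mathcal{P}$. Then $(\ast)$ is projectively isomonodromic if and only if for each $i=1,\dots,m$ there exist analytic functions $b_i:\mathcal{P}\to\mathbb{C}\cdot I_n$ (scalar matrices, possibly zero) and $B_i:\mathcal{P}\to\mathfrak{gl}_n(\mathbb{C})$ such that (1) $A_i=B_i+b_i$ for $i=1,\dots,m$, and (2) the equation $$\frac{dY}{dx}=\left(\sum_{i=1}^m\frac{B_i(t)}{x-x_i(t)}\right)Y$$ is isomonodromic.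
   Context: "Analytic on $\mathcal{D}\times\mathcal{P}$" includes the point $x=\infty$ if $\infty\in\mathcal{D}$: the equation is then non-singular at $\infty$, i.e. the sum of the residue matrices vanishes identically on $\mathcal{P}$. Let $\gamma_1,\dots,\gamma_m$ be the usual loops based at $x_0$ in $\mathcal{D}$, $\gamma_i$ encircling $D_i$ once, generating $\pi_1(\mathcal{D},x_0)$. A parameterized equation $\frac{dY}{dx}=A(x,t)Y$, analytic on $\mathcal{D}\times\mathcal{P}$, is *projectively isomonodromic* if there exist analytic functions $c_1,\dots,c_m$ from $\mathcal{P}$ to the group of nonzero scalar $n\times n$ complex matrices and fixed matrices $G_1,\dots,G_m\in\mathrm{GL}_n(\mathbb{C})$ such that for each $t\in\mathcal{P}$ there is a local fundamental solution $Y_t(x)$ at $x_0$ whose analytic continuation along $\gamma_i$ is $Y_t(x)\,G_i\,c_i(t)$, for each $i$. It is *isomonodromic* if there are fixed matrices $G_1,\dots,G_m\in\mathrm{GL}_n(\mathbb{C})$ such that for each $t\in\mathcal{P}$ there is a local fundamental solution $Y_t(x)$ at $x_0$ whose analytic continuation along $\gamma_i$ is $Y_t(x)\,G_i$, for each $i$ (equivalently, the monodromy representations for different $t$ are all conjugate). *)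

theory Defs
  imports "HOL-Complex_Analysis.Complex_Analysis"
begin

subsection \<open>The projective line\<close>

datatype riemann_sphere = Fin complex | Infty

text \<open>The topology of the one-point compactification of the complex plane.\<close>

instantiation riemann_sphere :: topological_space
begin

definition open_riemann_sphere :: "riemann_sphere set \<Rightarrow> bool" where
  "open_riemann_sphere U \<longleftrightarrow>
     open (Fin -` U) \<and> (Infty \<in> U \<longrightarrow> compact (- (Fin -` U)))"

instance
proof
  show "open (UNIV :: riemann_sphere set)"
    by (simp add: open_riemann_sphere_def)
next
  fix S T :: "riemann_sphere set"
  assume "open S" "open T"
  then show "open (S \<inter> T)"
    by (auto simp: open_riemann_sphere_def vimage_Int Compl_Int)
next
  fix K :: "riemann_sphere set set"
  assume K: "\<forall>S\<in>K. open S"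
  have op: "open (Fin -` \<Union>K)"
    using K by (auto simp: open_riemann_sphere_def vimage_Union)
  moreover have "compact (- (Fin -` \<Union>K))" if "Infty \<in> \<Union>K"
  proof -
    from that obtain S where S: "S \<in> K" "Infty \<in> S"
      by blast
    have "compact (- (Fin -` S))"
      using K S by (auto simp: open_riemann_sphere_def)
    moreover have "closed (- (Fin -` \<Union>K))"
      using op by (simp add: closed_def)
    ultimately have "compact (- (Fin -` S) \<inter> - (Fin -` \<Union>K))"
      by (rule compact_Int_closed)
    moreover have "- (Fin -` S) \<inter> - (Fin -` \<Union>K) = - (Fin -` \<Union>K)"
      using S by auto
    ultimately show ?thesis by simp
  qed
  ultimately show "open (\<Union>K)"
    by (simp add: open_riemann_sphere_def)
qed

end

definition chart_Infty :: "complex \<Rightarrow> riemann_sphere" where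
  "chart_Infty w = (if w = 0 then Infty else Fin (1 / w))"

text \<open>
  Closed disks of the projective line, i.e. the images of the closed unit disk under Moebius
  transformations: disks in the plane, complements of open disks, and half-planes, the last two
  containing the point at infinity.
\<close>

definition closed_disk :: "riemann_sphere set \<Rightarrow> bool" where
  "closed_disk S \<longleftrightarrow>
     (\<exists>a r. r > 0 \<and> S = Fin ` cball a r) \<or>
     (\<exists>a r. r > 0 \<and> S = - Fin ` ball a r) \<or>
     (\<exists>u b. u \<noteq> 0 \<and> S = insert Infty (Fin ` {z. u \<bullet> z \<le> b}))"

subsection \<open>Loops\<close>

text \<open>
  The loop is freely homotopic in \<open>D\<close> to the positively oriented boundary of a disk \<open>E\<close> that is
  a neighbourhood of \<open>S\<close> with \<open>E - S\<close> contained in \<open>D\<close>. In the second case \<open>E\<close> is the outside of a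
  circle, so its boundary runs clockwise in the plane.
\<close>

definition encircles_once ::
    "riemann_sphere set \<Rightarrow> riemann_sphere set \<Rightarrow> (real \<Rightarrow> riemann_sphere) \<Rightarrow> bool" where
  "encircles_once D S g \<longleftrightarrow> (\<exists>a R. R > 0 \<and>
     (S \<subseteq> Fin ` ball a R \<and> Fin ` cball a R - S \<subseteq> D \<and>
        homotopic_loops D g (Fin \<circ> circlepath a R) \<or>
      S \<subseteq> - Fin ` cball a R \<and> - Fin ` ball a R - S \<subseteq> D \<and>
        homotopic_loops D g (Fin \<circ> reversepath (circlepath a R))))"

text \<open>The loops representing elements of the subgroup of \<open>\<pi>\<^sub>1(S, x0)\<close> generated by \<open>L\<close>.\<close>

inductive_set generated_loops ::
    "'a::topological_space set \<Rightarrow> 'a \<Rightarrow> (real \<Rightarrow> 'a) set \<Rightarrow> (real \<Rightarrow> 'a) set"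
  for S x0 L where
  const: "(\<lambda>_. x0) \<in> generated_loops S x0 L"
| gen: "g \<in> L \<Longrightarrow> g \<in> generated_loops S x0 L"
| reverse: "p \<in> generated_loops S x0 L \<Longrightarrow> reversepath p \<in> generated_loops S x0 L"
| join: "\<lbrakk>p \<in> generated_loops S x0 L; q \<in> generated_loops S x0 L\<rbrakk> \<Longrightarrow>
    p +++ q \<in> generated_loops S x0 L"
| homotopic: "\<lbrakk>p \<in> generated_loops S x0 L; homotopic_paths S p q\<rbrakk> \<Longrightarrow>
    q \<in> generated_loops S x0 L"

definition loops_at :: "'a::topological_space set \<Rightarrow> 'a \<Rightarrow> (real \<Rightarrow> 'a) set" where
  "loops_at S x0 =
     {p. path p \<and> path_image p \<subseteq> S \<and> pathstart p = x0 \<and> pathfinish p = x0}"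

definition usual_loops ::
    "riemann_sphere set \<Rightarrow> nat \<Rightarrow> (nat \<Rightarrow> riemann_sphere set) \<Rightarrow> riemann_sphere
      \<Rightarrow> (nat \<Rightarrow> real \<Rightarrow> riemann_sphere) \<Rightarrow> bool" where
  "usual_loops D m Dk x0 \<gamma> \<longleftrightarrow>
     (\<forall>i\<in>{1..m}. \<gamma> i \<in> loops_at D x0 \<and> encircles_once D (Dk i) (\<gamma> i)) \<and>
     loops_at D x0 \<subseteq> generated_loops D x0 (\<gamma> ` {1..m})"

subsection \<open>Analytic functions\<close>

text \<open>
  Analyticity in several complex variables on an open set is complex differentiability, as for
  the one-variable \<^const>\<open>holomorphic_on\<close>: the Frechet derivative exists and is complex linear.
\<close>

definition sc_analytic_on :: "(complex^'r \<Rightarrow> complex) \<Rightarrow> (complex^'r) set \<Rightarrow> bool" where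
  "sc_analytic_on f P \<longleftrightarrow>
     (\<forall>t\<in>P. \<exists>v. (f has_derivative (\<lambda>k. \<Sum>j\<in>UNIV. v $ j * k $ j)) (at t))"

definition mat_analytic_on ::
    "(complex^'r \<Rightarrow> complex^'n^'n) \<Rightarrow> (complex^'r) set \<Rightarrow> bool" where
  "mat_analytic_on F P \<longleftrightarrow> (\<forall>k l. sc_analytic_on (\<lambda>t. F t $ k $ l) P)"

definition mat_analytic_on_Times ::
    "(complex \<Rightarrow> complex^'r \<Rightarrow> complex^'n^'n) \<Rightarrow> complex set \<Rightarrow> (complex^'r) set \<Rightarrow> bool" where
  "mat_analytic_on_Times F W P \<longleftrightarrow>
     (\<forall>x\<in>W. \<forall>t\<in>P. \<forall>k l. \<exists>a v.
        ((\<lambda>(y, s). F y s $ k $ l) has_derivative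
           (\<lambda>(h, d). a * h + (\<Sum>j\<in>UNIV. v $ j * d $ j))) (at (x, t)))"

definition sphere_analytic_at ::
    "(riemann_sphere \<Rightarrow> complex^'n^'n) \<Rightarrow> riemann_sphere \<Rightarrow> bool" where
  "sphere_analytic_at Y p \<longleftrightarrow> (\<forall>k l.
     case p of
       Fin x \<Rightarrow> (\<lambda>z. Y (Fin z) $ k $ l) analytic_on {x}
     | Infty \<Rightarrow> (\<lambda>w. Y (chart_Infty w) $ k $ l) analytic_on {0})"

subsection \<open>Parameterized linear differential equations\<close>

text \<open>
  An equation \<open>dY/dx = A(x,t) Y\<close> is given by its coefficient \<open>A\<close>. In the coordinate \<open>w = 1/x\<close> at
  infinity it reads \<open>dY/dw = -w\<^sup>-\<^sup>2 A(1/w,t) Y\<close>, and its coefficient has to extend analytically to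
  \<open>w = 0\<close> if \<open>D\<close> contains infinity. The scalar matrix \<open>c I\<close> is \<^term>\<open>mat c\<close>.
\<close>

definition analytic_equation ::
    "riemann_sphere set \<Rightarrow> (complex^'r) set \<Rightarrow> (complex \<Rightarrow> complex^'r \<Rightarrow> complex^'n^'n) \<Rightarrow> bool"
  where
  "analytic_equation D P A \<longleftrightarrow>
     mat_analytic_on_Times A (Fin -` D) P \<and>
     (Infty \<in> D \<longrightarrow>
        (\<exists>C. mat_analytic_on_Times C (chart_Infty -` D) P \<and>
           (\<forall>w\<in>chart_Infty -` D - {0}. \<forall>t\<in>P. C w t = mat (- 1 / w\<^sup>2) ** A (1 / w) t)))"

definition fuchsian ::
    "nat \<Rightarrow> (nat \<Rightarrow> complex^'r \<Rightarrow> complex^'n^'n) \<Rightarrow> (nat \<Rightarrow> complex^'r \<Rightarrow> complex)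
      \<Rightarrow> complex \<Rightarrow> complex^'r \<Rightarrow> complex^'n^'n" where
  "fuchsian m A \<xi> x t = (\<Sum>i\<in>{1..m}. mat (1 / (x - \<xi> i t)) ** A i t)"

text \<open>
  Invertible analytic solutions near \<open>p\<close>. For \<open>p = Infty\<close> the equation is imposed at the finite
  points near infinity; by continuity it then also holds at infinity in the coordinate \<open>1/x\<close>.
\<close>

definition fundamental_solution_at ::
    "(complex \<Rightarrow> complex^'n^'n) \<Rightarrow> riemann_sphere \<Rightarrow> (riemann_sphere \<Rightarrow> complex^'n^'n) \<Rightarrow> bool"
  where
  "fundamental_solution_at A p Y \<longleftrightarrow>
     sphere_analytic_at Y p \<and>
     (\<forall>\<^sub>F q in nhds p. invertible (Y q) \<and>
        (\<forall>x. q = Fin x \<longrightarrow>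
           (\<forall>k l. ((\<lambda>z. Y (Fin z) $ k $ l) has_field_derivative (A x ** Y (Fin x)) $ k $ l) (at x))))"

text \<open>
  The germ of \<open>f\<close> at the start of \<open>g\<close> has an analytic continuation along \<open>g\<close>, which ends in the
  germ of \<open>h\<close>. Here \<open>F s\<close> represents the germ at \<open>g s\<close>.
\<close>

definition continues_along ::
    "(real \<Rightarrow> riemann_sphere) \<Rightarrow> (riemann_sphere \<Rightarrow> complex^'n^'n)
      \<Rightarrow> (riemann_sphere \<Rightarrow> complex^'n^'n) \<Rightarrow> bool" where
  "continues_along g f h \<longleftrightarrow> (\<exists>F :: real \<Rightarrow> riemann_sphere \<Rightarrow> complex^'n^'n.
     (\<forall>s\<in>{0..1}. sphere_analytic_at (F s) (g s)) \<and>
     (\<forall>s\<in>{0..1}. \<forall>\<^sub>F u in at s within {0..1}. \<forall>\<^sub>F q in nhds (g u). F u q = F s q) \<and>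
     (\<forall>\<^sub>F q in nhds (pathstart g). F 0 q = f q) \<and>
     (\<forall>\<^sub>F q in nhds (pathfinish g). F 1 q = h q))"

definition projectively_isomonodromic ::
    "riemann_sphere set \<Rightarrow> (complex^'r) set \<Rightarrow> riemann_sphere \<Rightarrow> nat
      \<Rightarrow> (nat \<Rightarrow> real \<Rightarrow> riemann_sphere) \<Rightarrow> (complex \<Rightarrow> complex^'r \<Rightarrow> complex^'n^'n) \<Rightarrow> bool" where
  "projectively_isomonodromic D P x0 m \<gamma> A \<longleftrightarrow>
     analytic_equation D P A \<and>
     (\<exists>(c :: nat \<Rightarrow> complex^'r \<Rightarrow> complex^'n^'n) (G :: nat \<Rightarrow> complex^'n^'n).
        (\<forall>i\<in>{1..m}. mat_analytic_on (c i) P \<and> c i ` P \<subseteq> mat ` (- {0}) \<and> invertible (G i)) \<and>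
        (\<forall>t\<in>P. \<exists>Y. fundamental_solution_at (\<lambda>x. A x t) x0 Y \<and>
           (\<forall>i\<in>{1..m}. continues_along (\<gamma> i) Y (\<lambda>q. Y q ** G i ** c i t))))"

definition isomonodromic ::
    "riemann_sphere set \<Rightarrow> (complex^'r) set \<Rightarrow> riemann_sphere \<Rightarrow> nat
      \<Rightarrow> (nat \<Rightarrow> real \<Rightarrow> riemann_sphere) \<Rightarrow> (complex \<Rightarrow> complex^'r \<Rightarrow> complex^'n^'n) \<Rightarrow> bool" where
  "isomonodromic D P x0 m \<gamma> A \<longleftrightarrow>
     analytic_equation D P A \<and>
     (\<exists>G :: nat \<Rightarrow> complex^'n^'n.
        (\<forall>i\<in>{1..m}. invertible (G i)) \<and>
        (\<forall>t\<in>P. \<exists>Y. fundamental_solution_at (\<lambda>x. A x t) x0 Y \<and>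
           (\<forall>i\<in>{1..m}. continues_along (\<gamma> i) Y (\<lambda>q. Y q ** G i))))"

end

theory Submission
  imports Defs
begin

text \<open>
  Adding scalar residues \<open>\<beta>\<^sub>j(t)\<close> multiplies the solutions by a solution \<open>\<sigma>\<^sub>t\<close> of
  \<open>dy/dx = (\<Sum>j. \<beta>\<^sub>j(t) / (x - \<xi>\<^sub>j(t))) y\<close>, and hence the monodromy along \<open>\<gamma>\<^sub>i\<close> by a nonzero number
  \<open>\<mu>\<^sub>i(t)\<close>. Transporting explicit local solutions along a subdivision of \<open>\<gamma>\<^sub>i\<close> shows that \<open>\<mu>\<^sub>i\<close> is
  analytic, without any residue computation; this gives projective isomonodromy from isomonodromy.
  Conversely, take for \<open>B\<^sub>i\<close> the trace-free part of \<open>A\<^sub>i\<close>. By Liouville's formula the determinant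
  of a fundamental solution of the new equation is constant, so its monodromy \<open>G\<^sub>i c\<^sub>i(t) \<mu>\<^sub>i(t)\<close> has
  determinant \<open>1\<close>. The continuous function \<open>c\<^sub>i \<mu>\<^sub>i\<close> on the connected set \<open>P\<close> thus satisfies
  \<open>(c\<^sub>i \<mu>\<^sub>i)\<^sup>n = 1 / det G\<^sub>i\<close> and is constant. The traces have sum zero if infinity is a regular
  point, since the residues \<open>A\<^sub>i\<close> do.
\<close>


subsection \<open>Charts of the projective line\<close>

text \<open>All finite points share the chart \<open>Fin\<close>, so near them the coordinate is x
  itself and derivatives need no translation; \<open>centre p\<close> is the coordinate of p in its
  chart.\<close>

definition chart :: "riemann_sphere \<Rightarrow> complex \<Rightarrow> riemann_sphere" where
  "chart p = (case p of Fin _ \<Rightarrow> Fin | Infty \<Rightarrow> chart_Infty)"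

definition centre :: "riemann_sphere \<Rightarrow> complex" where
  "centre p = (case p of Fin x \<Rightarrow> x | Infty \<Rightarrow> 0)"

lemma chart_simps [simp]:
  "chart (Fin x) = Fin" "chart Infty = chart_Infty" "centre (Fin x) = x" "centre Infty = 0"
  by (simp_all add: chart_def centre_def)

lemma chart_centre [simp]: "chart p (centre p) = p"
  by (cases p) (auto simp: chart_Infty_def)

lemma inj_chart: "inj (chart p)"
  by (cases p) (auto simp: inj_def chart_Infty_def)

lemma open_Fin_image:
  assumes "open T"
  shows "open (Fin ` T)"
proof -
  have "Fin -` Fin ` T = T"
    by (auto simp: vimage_def)
  then show ?thesis
    using assms by (auto simp: open_riemann_sphere_def)
qed

lemma open_chart_Infty_ball:
  assumes "r > 0"
  shows "open (chart_Infty ` ball 0 r)"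
proof -
  \<comment> \<open>Inversion turns the chart disk of radius r at \<open>Infty\<close> into the
    outside of the closed disk of radius 1/r; what is left out is compact, as openness at
    \<open>Infty\<close> demands.\<close>
  have *: "Fin -` chart_Infty ` ball 0 r = - cball 0 (1 / r)"
  proof (intro set_eqI iffI)
    fix z assume "z \<in> Fin -` chart_Infty ` ball 0 r"
    then obtain w where "norm w < r" "w \<noteq> 0" "z = 1 / w"
      by (auto simp: chart_Infty_def split: if_splits)
    then have "1 / r < norm z"
      using assms by (simp add: norm_divide frac_less2)
    then show "z \<in> - cball 0 (1 / r)"
      by simp
  next
    fix z :: complex assume "z \<in> - cball 0 (1 / r)"
    then have z: "norm z > 1 / r" by auto
    with assms have "z \<noteq> 0"
      by auto
    moreover have "norm (1 / z) < r"
      using z assms \<open>z \<noteq> 0\<close> by (auto simp: norm_divide field_simps)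
    ultimately show "z \<in> Fin -` chart_Infty ` ball 0 r"
      by (auto simp: chart_Infty_def intro!: image_eqI[of _ _ "1 / z"])
  qed
  show ?thesis
    unfolding open_riemann_sphere_def * by (auto intro: open_Compl)
qed

lemma open_chart_ball:
  assumes "r > 0"
  shows "open (chart p ` ball (centre p) r)"
  using assms by (cases p) (auto intro: open_Fin_image open_chart_Infty_ball)

text \<open>At \<open>Infty\<close> the complement of S is compact, hence bounded by some K, and the
  radius 1/K works.\<close>

lemma chart_ball_subset:
  assumes "open S" "p \<in> S"
  obtains r where "r > 0" "chart p ` ball (centre p) r \<subseteq> S"
proof (cases p)
  case (Fin x)
  then have "open (Fin -` S)" "x \<in> Fin -` S"
    using assms by (auto simp: open_riemann_sphere_def)
  then obtain r where "r > 0" "ball x r \<subseteq> Fin -` S"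
    using open_contains_ball by blast
  then show ?thesis
    using that Fin by auto
next
  case Infty
  then have "bounded (- (Fin -` S))"
    using assms by (auto simp: open_riemann_sphere_def compact_imp_bounded)
  then obtain K where K: "K > 0" "\<And>z. Fin z \<notin> S \<Longrightarrow> norm z \<le> K"
    unfolding bounded_pos by auto
  have "chart_Infty ` ball 0 (1 / K) \<subseteq> S"
  proof
    fix q assume "q \<in> chart_Infty ` ball 0 (1 / K)"
    then obtain w where w: "norm w < 1 / K" "q = chart_Infty w" by auto
    show "q \<in> S"
    proof (cases "w = 0")
      case True
      then show ?thesis using w Infty assms by (simp add: chart_Infty_def)
    next
      case False
      then have "norm (1 / w) > K"
        using w K(1) by (simp add: norm_divide field_simps)
      then show ?thesis
        using w False K(2) by (force simp: chart_Infty_def)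
    qed
  qed
  then show ?thesis
    using that[of "1 / K"] K Infty by auto
qed

text \<open>The chart is open and continuous at \<open>centre p\<close>, by the two preceding
  lemmas. Rewriting with this equation turns eventuality on the sphere into eventuality in the
  complex plane.\<close>

lemma nhds_eq_filtermap_chart: "nhds p = filtermap (chart p) (nhds (centre p))"
proof (rule filter_eqI)
  fix Q
  show "eventually Q (nhds p) \<longleftrightarrow> eventually Q (filtermap (chart p) (nhds (centre p)))"
  proof
    assume "eventually Q (nhds p)"
    then obtain S where S: "open S" "p \<in> S" "\<forall>q\<in>S. Q q"
      unfolding eventually_nhds by auto
    then obtain r where "r > 0" "chart p ` ball (centre p) r \<subseteq> S"
      using chart_ball_subset by blast
    then show "eventually Q (filtermap (chart p) (nhds (centre p)))"
      unfolding eventually_filtermap eventually_nhds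
      using S by (intro exI[of _ "ball (centre p) r"]) auto
  next
    assume "eventually Q (filtermap (chart p) (nhds (centre p)))"
    then obtain T where T: "open T" "centre p \<in> T" "\<forall>z\<in>T. Q (chart p z)"
      unfolding eventually_filtermap eventually_nhds by auto
    then obtain r where r: "r > 0" "ball (centre p) r \<subseteq> T"
      using open_contains_ball by blast
    have "p \<in> chart p ` ball (centre p) r"
      using r by (intro image_eqI[of _ _ "centre p"]) auto
    then show "eventually Q (nhds p)"
      unfolding eventually_nhds
      using open_chart_ball[OF r(1)] T r by (intro exI[of _ "chart p ` ball (centre p) r"]) auto
  qed
qed

subsection \<open>Analytic germs and their continuation\<close>

text \<open>The scalar form of \<open>sphere_analytic_at\<close>, with both cases merged through
  \<open>chart\<close> so that the rules for \<open>analytic_on\<close> apply directly.\<close>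

definition sphere_analytic :: "(riemann_sphere \<Rightarrow> complex) \<Rightarrow> riemann_sphere \<Rightarrow> bool" where
  "sphere_analytic f p \<longleftrightarrow> (\<lambda>z. f (chart p z)) analytic_on {centre p}"

lemma sphere_analytic_at_iff:
  "sphere_analytic_at Y p \<longleftrightarrow> (\<forall>k l. sphere_analytic (\<lambda>q. Y q $ k $ l) p)"
  by (cases p) (simp_all add: sphere_analytic_at_def sphere_analytic_def)

lemma sphere_analytic_const [simp]: "sphere_analytic (\<lambda>_. c) p"
  by (simp add: sphere_analytic_def)

lemma sphere_analytic_mult:
  "sphere_analytic f p \<Longrightarrow> sphere_analytic g p \<Longrightarrow> sphere_analytic (\<lambda>q. f q * g q) p"
  unfolding sphere_analytic_def by (intro analytic_intros)

lemma sphere_analytic_sum: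
  "(\<And>i. i \<in> I \<Longrightarrow> sphere_analytic (f i) p) \<Longrightarrow> sphere_analytic (\<lambda>q. \<Sum>i\<in>I. f i q) p"
  unfolding sphere_analytic_def by (intro analytic_intros)

lemma sphere_analytic_prod:
  "(\<And>i. i \<in> I \<Longrightarrow> sphere_analytic (f i) p) \<Longrightarrow> sphere_analytic (\<lambda>q. \<Prod>i\<in>I. f i q) p"
  unfolding sphere_analytic_def by (intro analytic_intros)

lemma sphere_analytic_det:
  "sphere_analytic_at Y p \<Longrightarrow> sphere_analytic (\<lambda>q. det (Y q)) p"
  unfolding det_def sphere_analytic_at_iff
  by (intro sphere_analytic_sum sphere_analytic_mult sphere_analytic_prod sphere_analytic_const) auto

lemma sphere_analytic_at_mult:
  "sphere_analytic_at Y p \<Longrightarrow> sphere_analytic_at Z p \<Longrightarrow> sphere_analytic_at (\<lambda>q. Y q ** Z q) p"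
  unfolding sphere_analytic_at_iff matrix_matrix_mult_def
  by (auto intro!: sphere_analytic_sum sphere_analytic_mult)

lemma sphere_analytic_at_mat:
  "sphere_analytic f p \<Longrightarrow> sphere_analytic_at (\<lambda>q. mat (f q) :: complex^'n^'n) p"
  unfolding sphere_analytic_at_iff
proof (intro allI)
  fix k l :: 'n
  assume "sphere_analytic f p"
  then show "sphere_analytic (\<lambda>q. (mat (f q) :: complex^'n^'n) $ k $ l) p"
    by (cases "k = l") (simp_all add: mat_def)
qed

text \<open>Zeros of an analytic function are isolated unless it vanishes nearby. The second
  alternative excludes p itself, where nothing is claimed.\<close>

lemma sphere_analytic_dichotomy:
  assumes "sphere_analytic f p"
  shows "(\<forall>\<^sub>F q in nhds p. f q = c) \<or> (\<forall>\<^sub>F q in nhds p. q \<noteq> p \<longrightarrow> f q \<noteq> c)"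
proof -
  define h where "h z = f (chart p z) - c" for z
  have an: "h analytic_on {centre p}"
    using assms unfolding sphere_analytic_def h_def by (intro analytic_intros)
  show ?thesis
  proof (cases "\<exists>\<^sub>F z in at (centre p). h z \<noteq> 0")
    case True
    have "\<forall>\<^sub>F z in at (centre p). h z \<noteq> 0"
      using non_zero_neighbour[OF _ _ True] an
      by (simp add: isolated_singularity_at_analytic not_essential_analytic)
    then have "\<forall>\<^sub>F z in nhds (centre p). chart p z \<noteq> p \<longrightarrow> f (chart p z) \<noteq> c"
      unfolding eventually_at_filter
      by (rule eventually_mono) (auto simp: h_def)
    then show ?thesis
      by (simp add: nhds_eq_filtermap_chart[of p] eventually_filtermap)
  next
    case False
    then have ev: "\<forall>\<^sub>F z in at (centre p). h z = 0"
      by (simp add: not_frequently)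
    \<comment> \<open>Vanishing on a punctured neighbourhood says nothing at the centre; continuity
      supplies the value there.\<close>
    have "isCont h (centre p)"
      using an analytic_at_imp_isCont by blast
    then have "(h \<longlongrightarrow> h (centre p)) (at (centre p))"
      by (simp add: isCont_def)
    moreover have "(h \<longlongrightarrow> 0) (at (centre p))"
      using ev by (simp add: tendsto_eventually)
    ultimately have "h (centre p) = 0"
      using tendsto_unique by (metis trivial_limit_at)
    with ev have "\<forall>\<^sub>F z in nhds (centre p). h z = 0"
      by (simp add: eventually_nhds_conv_at)
    then have "\<forall>\<^sub>F z in nhds (centre p). f (chart p z) = c"
      by (simp add: h_def)
    then show ?thesis
      by (simp add: nhds_eq_filtermap_chart[of p] eventually_filtermap)
  qed
qed

text \<open>\<open>continues_along\<close> on an arbitrary interval, so that pieces of one path can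
  be concatenated without reparametrization.\<close>

definition continues_between ::
    "real \<Rightarrow> real \<Rightarrow> (real \<Rightarrow> riemann_sphere) \<Rightarrow> (riemann_sphere \<Rightarrow> complex^'n^'n)
      \<Rightarrow> (riemann_sphere \<Rightarrow> complex^'n^'n) \<Rightarrow> bool" where
  "continues_between a b g f h \<longleftrightarrow> (\<exists>F :: real \<Rightarrow> riemann_sphere \<Rightarrow> complex^'n^'n.
     (\<forall>s\<in>{a..b}. sphere_analytic_at (F s) (g s)) \<and>
     (\<forall>s\<in>{a..b}. \<forall>\<^sub>F u in at s within {a..b}. \<forall>\<^sub>F q in nhds (g u). F u q = F s q) \<and>
     (\<forall>\<^sub>F q in nhds (g a). F a q = f q) \<and>
     (\<forall>\<^sub>F q in nhds (g b). F b q = h q))"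

lemma continues_along_iff: "continues_along g f h \<longleftrightarrow> continues_between 0 1 g f h"
  by (simp add: continues_along_def continues_between_def pathstart_def pathfinish_def)

text \<open>The products of the two families of germs form a family for the product. Later the
  factors are a matrix solution and a scalar solution.\<close>

lemma continues_between_mult:
  assumes "continues_between a b g f h" "continues_between a b g f' h'"
  shows "continues_between a b g (\<lambda>q. f q ** f' q) (\<lambda>q. h q ** h' q)"
proof -
  obtain F where F: "\<forall>s\<in>{a..b}. sphere_analytic_at (F s) (g s)"
     "\<forall>s\<in>{a..b}. \<forall>\<^sub>F u in at s within {a..b}. \<forall>\<^sub>F q in nhds (g u). F u q = F s q"
     "\<forall>\<^sub>F q in nhds (g a). F a q = f q" "\<forall>\<^sub>F q in nhds (g b). F b q = h q"
    using assms(1) unfolding continues_between_def by blast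
  obtain F' where F': "\<forall>s\<in>{a..b}. sphere_analytic_at (F' s) (g s)"
     "\<forall>s\<in>{a..b}. \<forall>\<^sub>F u in at s within {a..b}. \<forall>\<^sub>F q in nhds (g u). F' u q = F' s q"
     "\<forall>\<^sub>F q in nhds (g a). F' a q = f' q" "\<forall>\<^sub>F q in nhds (g b). F' b q = h' q"
    using assms(2) unfolding continues_between_def by blast
  show ?thesis
    unfolding continues_between_def
  proof (intro exI[of _ "\<lambda>s q. F s q ** F' s q"] conjI ballI)
    fix s assume s: "s \<in> {a..b}"
    show "sphere_analytic_at (\<lambda>q. F s q ** F' s q) (g s)"
      using F(1) F'(1) s by (simp add: sphere_analytic_at_mult)
    show "\<forall>\<^sub>F u in at s within {a..b}. \<forall>\<^sub>F q in nhds (g u). F u q ** F' u q = F s q ** F' s q"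
      using F(2)[rule_format, OF s] F'(2)[rule_format, OF s]
    proof eventually_elim
      case (elim u)
      then show ?case by eventually_elim simp
    qed
  next
    show "\<forall>\<^sub>F q in nhds (g a). F a q ** F' a q = f q ** f' q"
      using F(3) F'(3) by eventually_elim simp
    show "\<forall>\<^sub>F q in nhds (g b). F b q ** F' b q = h q ** h' q"
      using F(4) F'(4) by eventually_elim simp
  qed
qed

lemma continues_between_cong:
  assumes "continues_between a b g f h"
    "\<forall>\<^sub>F q in nhds (g a). f q = f' q" "\<forall>\<^sub>F q in nhds (g b). h q = h' q"
  shows "continues_between a b g f' h'"
proof -
  obtain F where F: "\<forall>s\<in>{a..b}. sphere_analytic_at (F s) (g s)"
     "\<forall>s\<in>{a..b}. \<forall>\<^sub>F u in at s within {a..b}. \<forall>\<^sub>F q in nhds (g u). F u q = F s q"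
     "\<forall>\<^sub>F q in nhds (g a). F a q = f q" "\<forall>\<^sub>F q in nhds (g b). F b q = h q"
    using assms(1) unfolding continues_between_def by blast
  have "\<forall>\<^sub>F q in nhds (g a). F a q = f' q" "\<forall>\<^sub>F q in nhds (g b). F b q = h' q"
    using eventually_elim2[OF F(3) assms(2)] eventually_elim2[OF F(4) assms(3)] by simp_all
  then show ?thesis
    unfolding continues_between_def using F(1,2) by blast
qed

lemma continues_between_const:
  assumes "\<And>s. s \<in> {a..b} \<Longrightarrow> sphere_analytic_at f (g s)"
  shows "continues_between a b g f f"
  unfolding continues_between_def using assms by (intro exI[of _ "\<lambda>_. f"]) auto

text \<open>The two families are glued at b. Their germs at \<open>g b\<close> both equal the germ
  of h, and continuity of g carries this agreement to parameters near b.\<close>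

lemma continues_between_trans:
  assumes "continues_between a b g f h" "continues_between b c g h k"
    and ab: "a \<le> b" and bc: "b \<le> c" and cont: "continuous_on {a..c} g"
  shows "continues_between a c g f k"
proof -
  obtain F where F: "\<forall>s\<in>{a..b}. sphere_analytic_at (F s) (g s)"
     "\<forall>s\<in>{a..b}. \<forall>\<^sub>F u in at s within {a..b}. \<forall>\<^sub>F q in nhds (g u). F u q = F s q"
     "\<forall>\<^sub>F q in nhds (g a). F a q = f q" "\<forall>\<^sub>F q in nhds (g b). F b q = h q"
    using assms(1) unfolding continues_between_def by blast
  obtain F' where F': "\<forall>s\<in>{b..c}. sphere_analytic_at (F' s) (g s)"
     "\<forall>s\<in>{b..c}. \<forall>\<^sub>F u in at s within {b..c}. \<forall>\<^sub>F q in nhds (g u). F' u q = F' s q"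
     "\<forall>\<^sub>F q in nhds (g b). F' b q = h q" "\<forall>\<^sub>F q in nhds (g c). F' c q = k q"
    using assms(2) unfolding continues_between_def by blast
  \<comment> \<open>At b the left family is chosen, so the whole comparison of the two families
    takes place on the right-hand interval.\<close>
  define E where "E s = (if s \<le> b then F s else F' s)" for s
  have Eb: "\<forall>\<^sub>F q in nhds (g b). F' b q = F b q"
    using F'(3) F(4) by eventually_elim simp
  have right: "\<forall>\<^sub>F q in nhds (g s). F' s q = E s q" if "s \<in> {b..c}" for s
    using that Eb by (cases "s = b") (auto simp: E_def)
  have Eloc: "\<forall>\<^sub>F u in at s within {a..c}. \<forall>\<^sub>F q in nhds (g u). E u q = E s q"
    if s: "s \<in> {a..c}" for s
  proof -
    have left_part: "\<forall>\<^sub>F u in at s within {a..b}. \<forall>\<^sub>F q in nhds (g u). E u q = E s q"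
    proof (cases "s \<le> b")
      case True
      with s have "\<forall>\<^sub>F u in at s within {a..b}. \<forall>\<^sub>F q in nhds (g u). F u q = F s q"
        using F(2) by auto
      moreover have "\<forall>\<^sub>F u in at s within {a..b}. u \<in> {a..b}"
        by (simp add: eventually_at_filter)
      ultimately show ?thesis
      proof eventually_elim
        case (elim u)
        then show ?case using True by (simp add: E_def)
      qed
    next
      case False
      \<comment> \<open>For s beyond b the left-hand interval stays away from s, so the filter is
        trivial.\<close>
      then have "open {b<..}" "s \<in> {b<..}" "{a..b} \<inter> {b<..} - {s} = {} \<inter> {b<..} - {s}" by auto
      then have "at s within {a..b} = at s within {}"
        using at_within_nhd by metis
      then show ?thesis by simp
    qed
    have right_part: "\<forall>\<^sub>F u in at s within {b..c}. \<forall>\<^sub>F q in nhds (g u). E u q = E s q"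
    proof (cases "b \<le> s")
      case True
      with s have sb: "s \<in> {b..c}" by auto
      have "continuous_on {b..c} g"
        using cont by (rule continuous_on_subset) (use ab in auto)
      then have "(g \<longlongrightarrow> g s) (at s within {b..c})"
        using sb by (simp add: continuous_on_def)
      \<comment> \<open>A property holding near \<open>g s\<close> also holds near every point close
        to \<open>g s\<close>, in particular near \<open>g u\<close> for u close to s.\<close>
      moreover have "\<forall>\<^sub>F p in nhds (g s). \<forall>\<^sub>F q in nhds p. F' s q = E s q"
        using right[OF sb] by (simp add: eventually_eventually)
      ultimately have 1: "\<forall>\<^sub>F u in at s within {b..c}. \<forall>\<^sub>F q in nhds (g u). F' s q = E s q"
        unfolding filterlim_iff by blast
      have 2: "\<forall>\<^sub>F u in at s within {b..c}. \<forall>\<^sub>F q in nhds (g u). F' u q = F' s q"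
        using F'(2) sb by blast
      have 3: "\<forall>\<^sub>F u in at s within {b..c}. u \<in> {b..c}"
        by (simp add: eventually_at_filter)
      from 1 2 3 show ?thesis
      proof eventually_elim
        case (elim u)
        have "\<forall>\<^sub>F q in nhds (g u). F' u q = E u q"
          using right elim by blast
        with elim(1,2) show ?case by eventually_elim simp
      qed
    next
      case False
      then have "open {..<b}" "s \<in> {..<b}" "{b..c} \<inter> {..<b} - {s} = {} \<inter> {..<b} - {s}" by auto
      then have "at s within {b..c} = at s within {}"
        using at_within_nhd by metis
      then show ?thesis by simp
    qed
    have "{a..c} = {a..b} \<union> {b..c}"
      using ab bc by auto
    then show ?thesis
      using left_part right_part by (simp add: at_within_union eventually_sup)
  qed
  show ?thesis
    unfolding continues_between_def
  proof (intro exI[of _ E] conjI ballI)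
    fix s assume s: "s \<in> {a..c}"
    show "sphere_analytic_at (E s) (g s)"
      using F(1) F'(1) s by (auto simp: E_def)
    show "\<forall>\<^sub>F u in at s within {a..c}. \<forall>\<^sub>F q in nhds (g u). E u q = E s q"
      by (rule Eloc[OF s])
  next
    show "\<forall>\<^sub>F q in nhds (g a). E a q = f q"
      using F(3) ab by (simp add: E_def)
    have "\<forall>\<^sub>F q in nhds (g c). F' c q = E c q"
      using right bc by auto
    then show "\<forall>\<^sub>F q in nhds (g c). E c q = k q"
      using F'(4) by eventually_elim simp
  qed
qed

text \<open>The bisection principle \<open>Bolzano\<close>, with the local hypothesis phrased by
  filters: it suffices to treat intervals around s on which a property valid near s holds away from
  s itself.\<close>

lemma Bolzano_interval:
  fixes a b :: real
  assumes "a \<le> b"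
    and trans: "\<And>u v w. R u v \<Longrightarrow> R v w \<Longrightarrow> a \<le> u \<Longrightarrow> u \<le> v \<Longrightarrow> v \<le> w \<Longrightarrow> w \<le> b \<Longrightarrow> R u w"
    and local: "\<And>s. s \<in> {a..b} \<Longrightarrow> \<exists>Q. eventually Q (at s within {a..b}) \<and>
      (\<forall>u v. a \<le> u \<longrightarrow> u \<le> s \<longrightarrow> s \<le> v \<longrightarrow> v \<le> b \<longrightarrow>
        (\<forall>w\<in>{u..v} - {s}. Q w) \<longrightarrow> R u v)"
  shows "R a b"
proof -
  \<comment> \<open>The guards restrict R to subintervals of [a, b], because \<open>Bolzano\<close>
    quantifies over all reals.\<close>
  define R' where "R' u v \<longleftrightarrow> (a \<le> u \<longrightarrow> u \<le> v \<longrightarrow> v \<le> b \<longrightarrow> R u v)" for u v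
  from \<open>a \<le> b\<close> have "R' a b"
  proof (induction rule: Bolzano)
    case (trans u v w)
    then show ?case unfolding R'_def
      using assms(2)[of u v w] by auto
  next
    case (local s)
    then obtain Q where Q: "eventually Q (at s within {a..b})"
      "\<And>u v. a \<le> u \<Longrightarrow> u \<le> s \<Longrightarrow> s \<le> v \<Longrightarrow> v \<le> b \<Longrightarrow> (\<forall>w\<in>{u..v} - {s}. Q w) \<Longrightarrow> R u v"
      using assms(3)[of s] by auto
    obtain d where d: "d > 0" "\<And>w. w \<in> {a..b} \<Longrightarrow> w \<noteq> s \<Longrightarrow> dist w s < d \<Longrightarrow> Q w"
      using Q(1) unfolding eventually_at by auto
    show ?case
    proof (intro exI[of _ d] conjI allI impI)
      fix u v assume uv: "u \<le> s \<and> s \<le> v \<and> v - u < d"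
      show "R' u v"
        unfolding R'_def
      proof (intro impI)
        assume "a \<le> u" "u \<le> v" "v \<le> b"
        with uv show "R u v"
          by (intro Q(2) ballI d(2)) (auto simp: dist_real_def)
      qed
    qed (rule d(1))
  qed
  then show ?thesis
    using \<open>a \<le> b\<close> by (simp add: R'_def)
qed

text \<open>The condition that the germ of \<open>det (F s)\<close> is the constant c is locally
  constant in s, by the dichotomy for analytic functions, so it passes from 0 to 1.\<close>

lemma continues_along_det_const:
  assumes g: "continuous_on {0..1} g"
    and cont: "continues_along g f h"
    and f: "\<forall>\<^sub>F q in nhds (g 0). det (f q) = c"
  shows "\<forall>\<^sub>F q in nhds (g 1). det (h q) = c"
proof -
  obtain F where F: "\<forall>s\<in>{0..1}. sphere_analytic_at (F s) (g s)"
     "\<forall>s\<in>{0..1}. \<forall>\<^sub>F u in at s within {0..1}. \<forall>\<^sub>F q in nhds (g u). F u q = F s q"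
     "\<forall>\<^sub>F q in nhds (g 0). F 0 q = f q" "\<forall>\<^sub>F q in nhds (g 1). F 1 q = h q"
    using cont unfolding continues_along_iff continues_between_def by blast
  define C where "C s \<longleftrightarrow> (\<forall>\<^sub>F q in nhds (g s). det (F s q) = c)" for s
  have "C 0 \<longrightarrow> C 1"
  proof (rule Bolzano_interval[of 0 1 "\<lambda>u v. C u \<longrightarrow> C v"])
    fix s :: real assume s: "s \<in> {0..1}"
    have gs: "(g \<longlongrightarrow> g s) (at s within {0..1})"
      using g s by (simp add: continuous_on_def)
    have loc: "\<forall>\<^sub>F u in at s within {0..1}. \<forall>\<^sub>F q in nhds (g u). F u q = F s q"
      using F(2) s by blast
    have "sphere_analytic (\<lambda>q. det (F s q)) (g s)"
      using F(1) s by (simp add: sphere_analytic_det)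
    from sphere_analytic_dichotomy[OF this, of c]
    have "\<forall>\<^sub>F u in at s within {0..1}. C u \<longleftrightarrow> C s"
    proof
      assume *: "\<forall>\<^sub>F q in nhds (g s). det (F s q) = c"
      then have "\<forall>\<^sub>F p in nhds (g s). \<forall>\<^sub>F q in nhds p. det (F s q) = c"
        by (simp add: eventually_eventually)
      then have "\<forall>\<^sub>F u in at s within {0..1}. \<forall>\<^sub>F q in nhds (g u). det (F s q) = c"
        using gs unfolding filterlim_iff by blast
      with loc show ?thesis
      proof eventually_elim
        case (elim u)
        then have "C u"
          unfolding C_def by eventually_elim simp
        with * show ?case by (simp add: C_def)
      qed
    next
      \<comment> \<open>The germ at s is then not constantly c. A nearby u inherits this: from the
        value at \<open>g u\<close> if \<open>g u\<close> differs from \<open>g s\<close>, otherwise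
        because both germs agree and sit at one point.\<close>
      assume *: "\<forall>\<^sub>F q in nhds (g s). q \<noteq> g s \<longrightarrow> det (F s q) \<noteq> c"
      then have "\<forall>\<^sub>F u in at s within {0..1}. g u \<noteq> g s \<longrightarrow> det (F s (g u)) \<noteq> c"
        using gs unfolding filterlim_iff by blast
      with loc show ?thesis
      proof eventually_elim
        case (elim u)
        have "C u \<longleftrightarrow> (\<forall>\<^sub>F q in nhds (g u). det (F s q) = c)"
          unfolding C_def by (rule eventually_cong[OF elim(1)]) auto
        also have "\<dots> \<longleftrightarrow> C s"
        proof (cases "g u = g s")
          case False
          then have "\<not> (\<forall>\<^sub>F q in nhds (g u). det (F s q) = c)"
            using elim(2) eventually_nhds_x_imp_x by blast
          moreover have "\<not> C s"
          proof
            assume "C s"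
            \<comment> \<open>Both conditions together would make \<open>g s\<close> an isolated
              point of the sphere.\<close>
            then have "\<forall>\<^sub>F q in nhds (g s). q = g s"
              unfolding C_def using * by eventually_elim auto
            then have "\<forall>\<^sub>F z in nhds (centre (g s)). chart (g s) z = chart (g s) (centre (g s))"
              unfolding chart_centre
              by (simp add: nhds_eq_filtermap_chart[of "g s"] eventually_filtermap)
            then have "\<forall>\<^sub>F z in nhds (centre (g s)). z = centre (g s)"
              by (simp only: inj_eq[OF inj_chart])
            then have "\<forall>\<^sub>F z in at (centre (g s)). False"
              by (simp add: eventually_at_filter)
            then show False by simp
          qed
          ultimately show ?thesis by simp
        qed (simp add: C_def)
        finally show ?case .
      qed
    qed
    then show "\<exists>Q. eventually Q (at s within {0..1}) \<and>
      (\<forall>u v. 0 \<le> u \<longrightarrow> u \<le> s \<longrightarrow> s \<le> v \<longrightarrow> v \<le> 1 \<longrightarrow>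
        (\<forall>w\<in>{u..v} - {s}. Q w) \<longrightarrow> C u \<longrightarrow> C v)"
      by (intro exI[of _ "\<lambda>u. C u \<longleftrightarrow> C s"])
        (metis Diff_iff atLeastAtMost_iff order_refl order_trans singletonD)
  qed auto
  moreover have "C 0"
    unfolding C_def using F(3) f by eventually_elim simp
  ultimately have "\<forall>\<^sub>F q in nhds (g 1). det (F 1 q) = c"
    by (simp add: C_def)
  with F(4) show ?thesis
    by eventually_elim simp
qed

subsection \<open>Analytic functions of the parameter\<close>

lemma sc_analytic_on_const [simp]: "sc_analytic_on (\<lambda>_. c) P"
  unfolding sc_analytic_on_def by (auto intro!: exI[of _ 0])

lemma sc_analytic_on_chain:
  assumes "sc_analytic_on f P" "\<And>t. t \<in> P \<Longrightarrow> \<exists>d. (\<phi> has_field_derivative d) (at (f t))"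
  shows "sc_analytic_on (\<lambda>t. \<phi> (f t)) P"
  unfolding sc_analytic_on_def
proof
  fix t assume t: "t \<in> P"
  then obtain v d where v: "(f has_derivative (\<lambda>k. \<Sum>j\<in>UNIV. v $ j * k $ j)) (at t)"
    and d: "(\<phi> has_field_derivative d) (at (f t))"
    using assms unfolding sc_analytic_on_def by blast
  have "((\<lambda>t. \<phi> (f t)) has_derivative (\<lambda>k. d * (\<Sum>j\<in>UNIV. v $ j * k $ j))) (at t)"
    using has_derivative_compose[OF v] d by (simp add: has_field_derivative_def)
  then have "((\<lambda>t. \<phi> (f t)) has_derivative (\<lambda>k. \<Sum>j\<in>UNIV. (d *s v) $ j * k $ j)) (at t)"
    by (simp add: sum_distrib_left mult.assoc)
  then show "\<exists>v. ((\<lambda>t. \<phi> (f t)) has_derivative (\<lambda>k. \<Sum>j\<in>UNIV. v $ j * k $ j)) (at t)" ..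
qed

lemma sc_analytic_on_add:
  assumes "sc_analytic_on f P" "sc_analytic_on g P"
  shows "sc_analytic_on (\<lambda>t. f t + g t) P"
  unfolding sc_analytic_on_def
proof
  fix t assume t: "t \<in> P"
  then obtain v w where v: "(f has_derivative (\<lambda>k. \<Sum>j\<in>UNIV. v $ j * k $ j)) (at t)"
    and w: "(g has_derivative (\<lambda>k. \<Sum>j\<in>UNIV. w $ j * k $ j)) (at t)"
    using assms unfolding sc_analytic_on_def by blast
  have "((\<lambda>t. f t + g t) has_derivative (\<lambda>k. \<Sum>j\<in>UNIV. (v + w) $ j * k $ j)) (at t)"
    using has_derivative_add[OF v w] by (simp add: sum.distrib distrib_right)
  then show "\<exists>v. ((\<lambda>t. f t + g t) has_derivative (\<lambda>k. \<Sum>j\<in>UNIV. v $ j * k $ j)) (at t)" ..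
qed

lemma sc_analytic_on_mult:
  assumes "sc_analytic_on f P" "sc_analytic_on g P"
  shows "sc_analytic_on (\<lambda>t. f t * g t) P"
  unfolding sc_analytic_on_def
proof
  fix t assume t: "t \<in> P"
  then obtain v w where v: "(f has_derivative (\<lambda>k. \<Sum>j\<in>UNIV. v $ j * k $ j)) (at t)"
    and w: "(g has_derivative (\<lambda>k. \<Sum>j\<in>UNIV. w $ j * k $ j)) (at t)"
    using assms unfolding sc_analytic_on_def by blast
  have "((\<lambda>t. f t * g t) has_derivative
      (\<lambda>k. \<Sum>j\<in>UNIV. (f t *s w + g t *s v) $ j * k $ j)) (at t)"
    using has_derivative_mult[OF v w]
    by (simp add: sum.distrib sum_distrib_left sum_distrib_right algebra_simps)
  then show "\<exists>v. ((\<lambda>t. f t * g t) has_derivative (\<lambda>k. \<Sum>j\<in>UNIV. v $ j * k $ j)) (at t)" ..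
qed

lemma sc_analytic_on_diff:
  assumes "sc_analytic_on f P" "sc_analytic_on g P"
  shows "sc_analytic_on (\<lambda>t. f t - g t) P"
  using sc_analytic_on_add[OF assms(1) sc_analytic_on_mult[OF sc_analytic_on_const[of "-1"] assms(2)]]
  by simp

lemma sc_analytic_on_sum:
  "(\<And>i. i \<in> I \<Longrightarrow> sc_analytic_on (f i) P) \<Longrightarrow> sc_analytic_on (\<lambda>t. \<Sum>i\<in>I. f i t) P"
  by (induction I rule: infinite_finite_induct) (simp_all add: sc_analytic_on_add)

lemma sc_analytic_on_divide:
  assumes "sc_analytic_on f P" "sc_analytic_on g P" "\<And>t. t \<in> P \<Longrightarrow> g t \<noteq> 0"
  shows "sc_analytic_on (\<lambda>t. f t / g t) P"
proof -
  have "sc_analytic_on (\<lambda>t. inverse (g t)) P"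
    using assms(2,3) by (intro sc_analytic_on_chain[where \<phi> = inverse]) (auto intro: DERIV_inverse)
  from sc_analytic_on_mult[OF assms(1) this] show ?thesis
    by (simp add: divide_inverse)
qed

lemma sc_analytic_on_imp_continuous_on:
  assumes "sc_analytic_on f P"
  shows "continuous_on P f"
  using assms unfolding sc_analytic_on_def
  by (meson continuous_at_imp_continuous_on has_derivative_continuous)

subsection \<open>Local solutions of scalar Fuchsian equations\<close>

text \<open>
  Near a point \<open>p\<close> the equation \<open>dy/dx = (\<Sum>j. \<beta>\<^sub>j / (x - \<xi>\<^sub>j)) y\<close> has the solution
  \<open>\<Prod>j. (x - \<xi>\<^sub>j) powr \<beta>\<^sub>j\<close> normalized to be \<open>1\<close> at \<open>p\<close>. At infinity this is \<open>\<Prod>j. (1 - \<xi>\<^sub>j / x) powr \<beta>\<^sub>j\<close>, a solution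
  since the exponents \<open>\<beta>\<^sub>j\<close> then have sum zero. In a disk around \<open>p\<close> that contains no \<open>\<xi>\<^sub>j\<close> the
  bases of these powers have positive real part, so that principal logarithms can be used for
  all values of the parameter simultaneously.
\<close>

definition local_factor :: "riemann_sphere \<Rightarrow> complex \<Rightarrow> riemann_sphere \<Rightarrow> complex" where
  "local_factor p \<xi> q = (case q of Infty \<Rightarrow> 1 | Fin x \<Rightarrow>
     (case p of Fin a \<Rightarrow> (x - \<xi>) / (a - \<xi>) | Infty \<Rightarrow> 1 - \<xi> / x))"

definition multiplier ::
    "nat set \<Rightarrow> (nat \<Rightarrow> complex) \<Rightarrow> (nat \<Rightarrow> complex) \<Rightarrow> riemann_sphere \<Rightarrow> riemann_sphere \<Rightarrow> complex"
  where "multiplier J \<beta> \<xi> p q = exp (\<Sum>j\<in>J. \<beta> j * Ln (local_factor p (\<xi> j) q))"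

lemma local_factor_simps [simp]:
  "local_factor p \<xi> Infty = 1"
  "local_factor (Fin a) \<xi> (Fin x) = (x - \<xi>) / (a - \<xi>)"
  "local_factor Infty \<xi> (Fin x) = 1 - \<xi> / x"
  by (simp_all add: local_factor_def)

lemma local_factor_chart_Infty [simp]: "local_factor Infty \<xi> (chart_Infty w) = 1 - \<xi> * w"
  by (simp add: chart_Infty_def)

lemma multiplier_nonzero [simp]: "multiplier J \<beta> \<xi> p q \<noteq> 0"
  by (simp add: multiplier_def)

lemma Re_pos_if_near_1:
  assumes "norm (z - 1) < 1"
  shows "Re z > 0"
  using assms abs_Re_le_cmod[of "z - 1"] by auto

text \<open>The pole lies outside the disk while q lies inside. Hence the factor differs from 1 by
  (x - a) / (a - \<xi>), or by -\<xi> w at infinity, of modulus less than 1.\<close>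

lemma local_factor_pos:
  assumes sub: "chart p ` ball (centre p) r \<subseteq> D" and \<xi>: "Fin \<xi> \<notin> D"
    and q: "q \<in> chart p ` ball (centre p) r"
  shows "Re (local_factor p \<xi> q) > 0"
proof (cases p)
  case (Fin a)
  with q obtain x where x: "q = Fin x" "norm (x - a) < r"
    by (auto simp: dist_norm norm_minus_commute)
  have "\<xi> \<notin> ball a r"
    using sub \<xi> Fin by (auto simp: image_subset_iff)
  then have "norm (a - \<xi>) \<ge> r"
    by (simp add: dist_norm)
  moreover have "r > 0"
    using x norm_ge_zero le_less_trans by blast
  ultimately have "a \<noteq> \<xi>" "norm (x - a) < norm (a - \<xi>)"
    using x by auto
  moreover from this have "(x - \<xi>) / (a - \<xi>) - 1 = (x - a) / (a - \<xi>)"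
    by (simp add: field_simps)
  ultimately have "norm ((x - \<xi>) / (a - \<xi>) - 1) < 1"
    by (simp add: norm_divide)
  then show ?thesis
    using Fin x by (simp add: Re_pos_if_near_1)
next
  case Infty
  with q obtain w where w: "q = chart_Infty w" "norm w < r"
    by auto
  have "norm (\<xi> * w) < 1"
  proof (cases "\<xi> = 0")
    case False
    \<comment> \<open>In the coordinate at infinity the pole sits at 1 / \<xi>, so this point is
      outside the disk.\<close>
    have "1 / \<xi> \<notin> ball 0 r"
    proof
      assume "1 / \<xi> \<in> ball 0 r"
      then have "chart_Infty (1 / \<xi>) \<in> D"
        using sub Infty by auto
      then show False
        using \<xi> False by (simp add: chart_Infty_def)
    qed
    then have "norm w < norm (1 / \<xi>)"
      using w by simp
    then show ?thesis
      using False by (simp add: norm_mult norm_divide field_simps)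
  qed simp
  then show ?thesis
    using Infty w by (intro Re_pos_if_near_1) simp
qed

section \<open>Principal logarithms in the right half-plane\<close>

lemma Re_pos_notin_nonpos_Reals: "Re z > 0 \<Longrightarrow> z \<notin> \<real>\<^sub>\<le>\<^sub>0"
  by (auto simp: complex_nonpos_Reals_iff)

text \<open>Each logarithm has imaginary part strictly between -pi/2 and pi/2, so a sum of two stays
  within the principal strip and no multiple of 2 pi i appears.\<close>

lemma Ln_eq_if_mult_eq:
  assumes "Re a > 0" "Re b > 0" "Re c > 0" "Re d > 0" "a * b = c * d"
  shows "Ln a + Ln b = Ln c + Ln d"
proof -
  have nz: "a \<noteq> 0" "b \<noteq> 0" "c \<noteq> 0" "d \<noteq> 0"
    using assms by auto
  note im = assms(1-4)[THEN Re_Ln_pos_lt_imp]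
  have "Ln (a * b) = Ln a + Ln b"
    using nz im by (intro Ln_times_simple) linarith+
  moreover have "Ln (c * d) = Ln c + Ln d"
    using nz im by (intro Ln_times_simple) linarith+
  ultimately show ?thesis
    using assms(5) by simp
qed

lemma centre_in_chart_ball:
  assumes "q \<in> chart p ` ball (centre p) r"
  shows "p \<in> chart p ` ball (centre p) r"
  using assms by (intro image_eqI[of _ _ "centre p"]) (auto intro: le_less_trans[OF zero_le_dist])

lemma eventually_in_chart_ball:
  assumes "q \<in> chart p ` ball (centre p) r"
  shows "\<forall>\<^sub>F z in nhds q. z \<in> chart p ` ball (centre p) r"
proof -
  from assms have "r > 0"
    by (auto intro: le_less_trans[OF zero_le_dist])
  then show ?thesis
    using assms open_chart_ball by (intro eventually_nhds_in_open) auto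
qed

context
  fixes D :: "riemann_sphere set" and J :: "nat set" and \<beta> \<xi> :: "nat \<Rightarrow> complex"
  assumes D: "open D"
    and \<xi>: "\<And>j. j \<in> J \<Longrightarrow> Fin (\<xi> j) \<notin> D"
    and \<beta>: "Infty \<in> D \<Longrightarrow> (\<Sum>j\<in>J. \<beta> j) = 0"
begin

lemma multiplier_analytic:
  assumes sub: "chart p ` ball (centre p) r \<subseteq> D"
    and q: "q \<in> chart p ` ball (centre p) r"
  shows "sphere_analytic (multiplier J \<beta> \<xi> p) q"
proof -
  have pos: "local_factor p (\<xi> j) q \<notin> \<real>\<^sub>\<le>\<^sub>0" if "j \<in> J" for j
    using local_factor_pos[OF sub \<xi>[OF that] q] by (rule Re_pos_notin_nonpos_Reals)
  have an: "(\<lambda>z. local_factor p (\<xi> j) (chart q z)) analytic_on {centre q}" if "j \<in> J" for j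
  proof (cases p)
    case (Fin a)
    then have "a \<noteq> \<xi> j"
      using sub centre_in_chart_ball[OF q] \<xi>[OF that] by auto
    then show ?thesis
      using Fin q by (auto intro!: analytic_intros)
  next
    case Infty
    show ?thesis
    proof (cases q)
      case (Fin x)
      then have "x \<noteq> 0"
        using Infty q by (auto simp: chart_Infty_def split: if_splits)
      then show ?thesis
        using Infty Fin by (auto intro!: analytic_intros)
    next
      case q: Infty
      then show ?thesis
        using Infty by (auto intro!: analytic_intros)
    qed
  qed
  show ?thesis
    unfolding sphere_analytic_def multiplier_def
    using pos by (intro analytic_intros an) auto
qed

text \<open>Both sides are solutions near q with the same value there. The proof compares the
  factors directly: they multiply exactly when p is finite, while for infinite p an extra factor
  independent of the pole is removed by the vanishing sum of the \<beta> j.\<close>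

lemma multiplier_cocycle:
  assumes sub: "chart p ` ball (centre p) r \<subseteq> D"
    and q: "q \<in> chart p ` ball (centre p) r"
  shows "\<forall>\<^sub>F z in nhds q. multiplier J \<beta> \<xi> p z = multiplier J \<beta> \<xi> p q * multiplier J \<beta> \<xi> q z"
proof -
  obtain r' where r': "r' > 0" "chart q ` ball (centre q) r' \<subseteq> D"
    using chart_ball_subset[OF D] sub q by blast
  have "q \<in> chart q ` ball (centre q) r'"
    using r'(1) by (intro image_eqI[of _ _ "centre q"]) auto
  then have evq: "\<forall>\<^sub>F z in nhds q. z \<in> chart q ` ball (centre q) r'"
    by (rule eventually_in_chart_ball)
  note evp = eventually_in_chart_ball[OF q]
  show ?thesis
  proof (cases q)
    case Infty
    \<comment> \<open>The chart around a finite p never reaches \<open>Infty\<close>. At p = q the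
      value of the multiplier is 1.\<close>
    then have "p = Infty"
      using q by (cases p) auto
    then show ?thesis
      using Infty by (auto simp: multiplier_def)
  next
    case (Fin x)
    show ?thesis
    proof (cases p)
      case p: (Fin a)
      show ?thesis
        using evp evq
      proof eventually_elim
        case (elim z)
        then obtain y where y: "z = Fin y"
          using p by auto
        have "Ln (local_factor p (\<xi> j) z) = Ln (local_factor p (\<xi> j) q) + Ln (local_factor q (\<xi> j) z)"
          if j: "j \<in> J" for j
        proof -
          have "x \<noteq> \<xi> j"
            using Fin q sub \<xi>[OF j] by auto
          then have "local_factor p (\<xi> j) z * 1 = local_factor p (\<xi> j) q * local_factor q (\<xi> j) z"
            using Fin p y by simp
          from Ln_eq_if_mult_eq[OF _ _ _ _ this] show ?thesis
            using local_factor_pos[OF sub \<xi>[OF j]] local_factor_pos[OF r'(2) \<xi>[OF j]] elim q by simp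
        qed
        then show ?case
          by (simp add: multiplier_def distrib_left sum.distrib flip: exp_add)
      qed
    next
      case p: Infty
      have "Infty \<in> D"
        using sub p centre_in_chart_ball[OF q] by auto
      note \<beta>0 = \<beta>[OF this]
      have x0: "x \<noteq> 0"
        using Fin p q by (auto simp: chart_Infty_def split: if_splits)
      \<comment> \<open>Near x the quotient y / x is close to 1, so its principal logarithm may
        enter the additive identity below.\<close>
      then have "((\<lambda>y. y / x) \<longlongrightarrow> x / x) (nhds x)"
        by (intro tendsto_intros) (auto simp: filterlim_ident)
      then have "((\<lambda>y. Re (y / x)) \<longlongrightarrow> Re (x / x)) (nhds x)"
        by (rule tendsto_Re)
      then have "\<forall>\<^sub>F y in nhds x. Re (y / x) > 0"
        using x0 by (intro order_tendstoD(1)[of _ 1]) auto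
      then have "\<forall>\<^sub>F z in nhds q. \<forall>y. z = Fin y \<longrightarrow> Re (y / x) > 0"
        by (simp add: nhds_eq_filtermap_chart[of "Fin x"] eventually_filtermap Fin)
      then show ?thesis
        using evp evq
      proof eventually_elim
        case (elim z)
        then obtain y where y: "z = Fin y"
          using Fin by auto
        then have "y \<noteq> 0"
          using elim(1) by auto
        have "Ln (local_factor p (\<xi> j) z) =
            Ln (local_factor p (\<xi> j) q) + Ln (local_factor q (\<xi> j) z) - Ln (y / x)"
          if j: "j \<in> J" for j
        proof -
          have "x \<noteq> \<xi> j"
            using Fin q sub \<xi>[OF j] by auto
          \<comment> \<open>The product of the factors is (y - \<xi> j) / x; the factor at y alone
            is (y - \<xi> j) / y, which y / x corrects.\<close>
          then have "local_factor p (\<xi> j) z * (y / x) = local_factor p (\<xi> j) q * local_factor q (\<xi> j) z"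
            using Fin p y x0 \<open>y \<noteq> 0\<close> by (simp add: field_simps)
          from Ln_eq_if_mult_eq[OF _ _ _ _ this] show ?thesis
            using local_factor_pos[OF sub \<xi>[OF j]] local_factor_pos[OF r'(2) \<xi>[OF j]] elim q y
            by (simp add: algebra_simps)
        qed
        then have "(\<Sum>j\<in>J. \<beta> j * Ln (local_factor p (\<xi> j) z)) =
            (\<Sum>j\<in>J. \<beta> j * Ln (local_factor p (\<xi> j) q)) + (\<Sum>j\<in>J. \<beta> j * Ln (local_factor q (\<xi> j) z))
              - (\<Sum>j\<in>J. \<beta> j) * Ln (y / x)"
          by (simp add: distrib_left right_diff_distrib sum.distrib sum_subtractf sum_distrib_right)
        then show ?case
          by (simp add: multiplier_def \<beta>0 flip: exp_add)
      qed
    qed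
  qed
qed

lemma multiplier_has_field_derivative:
  assumes p: "p \<in> D"
  shows "\<forall>\<^sub>F q in nhds p. \<forall>x. q = Fin x \<longrightarrow>
    ((\<lambda>z. multiplier J \<beta> \<xi> p (Fin z)) has_field_derivative
      (\<Sum>j\<in>J. \<beta> j / (x - \<xi> j)) * multiplier J \<beta> \<xi> p (Fin x)) (at x)"
proof -
  obtain r where r: "r > 0" "chart p ` ball (centre p) r \<subseteq> D"
    using chart_ball_subset[OF D p] by blast
  have "p \<in> chart p ` ball (centre p) r"
    using r(1) by (intro image_eqI[of _ _ "centre p"]) auto
  then have "\<forall>\<^sub>F q in nhds p. q \<in> chart p ` ball (centre p) r"
    by (rule eventually_in_chart_ball)
  then show ?thesis
  proof eventually_elim
    case (elim q)
    show ?case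
    proof (intro allI impI)
      fix x assume x: "q = Fin x"
      have pos: "local_factor p (\<xi> j) (Fin x) \<notin> \<real>\<^sub>\<le>\<^sub>0" if "j \<in> J" for j
        using local_factor_pos[OF r(2) \<xi>[OF that] elim] x by (simp add: Re_pos_notin_nonpos_Reals)
      have x\<xi>: "x \<noteq> \<xi> j" if "j \<in> J" for j
        using \<xi>[OF that] r(2) elim x by auto
      \<comment> \<open>At infinity each logarithm of 1 - \<xi> j / x contributes an extra -1/x to
        the derivative; weighted by the \<beta> j these contributions cancel.\<close>
      define \<epsilon> where "\<epsilon> = (case p of Fin _ \<Rightarrow> 0 | Infty \<Rightarrow> 1 / x)"
      have der: "((\<lambda>z. Ln (local_factor p (\<xi> j) (Fin z))) has_field_derivative
          1 / (x - \<xi> j) - \<epsilon>) (at x)" if j: "j \<in> J" for j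
      proof (cases p)
        case (Fin a)
        then have "a \<noteq> \<xi> j"
          using p \<xi>[OF j] by auto
        have "((\<lambda>z. (z - \<xi> j) / (a - \<xi> j)) has_field_derivative 1 / (a - \<xi> j)) (at x)"
          using \<open>a \<noteq> \<xi> j\<close> by (auto intro!: derivative_eq_intros)
        from DERIV_chain2[OF has_field_derivative_Ln this] show ?thesis
          using pos[OF j] \<open>a \<noteq> \<xi> j\<close> Fin by (simp add: \<epsilon>_def)
      next
        case Infty
        then have "x \<noteq> 0"
          using x elim by (auto simp: chart_Infty_def split: if_splits)
        then show ?thesis
          using pos[OF j] x\<xi>[OF j] Infty
          by (auto intro!: derivative_eq_intros simp: \<epsilon>_def field_simps)
      qed
      have "(\<Sum>j\<in>J. \<beta> j) * \<epsilon> = 0"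
        using \<beta> p by (cases p) (auto simp: \<epsilon>_def)
      then have "(\<Sum>j\<in>J. \<beta> j * (1 / (x - \<xi> j) - \<epsilon>)) = (\<Sum>j\<in>J. \<beta> j / (x - \<xi> j))"
        by (simp add: right_diff_distrib sum_subtractf flip: sum_distrib_right)
      moreover have "((\<lambda>z. \<Sum>j\<in>J. \<beta> j * Ln (local_factor p (\<xi> j) (Fin z))) has_field_derivative
          (\<Sum>j\<in>J. \<beta> j * (1 / (x - \<xi> j) - \<epsilon>))) (at x)"
        by (intro DERIV_sum DERIV_cmult der)
      ultimately have "((\<lambda>z. \<Sum>j\<in>J. \<beta> j * Ln (local_factor p (\<xi> j) (Fin z))) has_field_derivative
          (\<Sum>j\<in>J. \<beta> j / (x - \<xi> j))) (at x)"
        by simp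
      from DERIV_chain2[OF DERIV_exp this]
      show "((\<lambda>z. multiplier J \<beta> \<xi> p (Fin z)) has_field_derivative
          (\<Sum>j\<in>J. \<beta> j / (x - \<xi> j)) * multiplier J \<beta> \<xi> p (Fin x)) (at x)"
        unfolding multiplier_def by (simp only: mult.commute)
    qed
  qed
qed

end

text \<open>For fixed p and q the logarithms stay on their principal branch for every t, because no
  pole enters the disk. Analyticity in t thus follows by composition.\<close>

lemma multiplier_parameter_analytic:
  assumes sub: "chart p ` ball (centre p) r \<subseteq> D"
    and q: "q \<in> chart p ` ball (centre p) r"
    and \<xi>: "\<And>j t. j \<in> J \<Longrightarrow> t \<in> P \<Longrightarrow> Fin (\<xi> j t) \<notin> D"
    and an: "\<And>j. j \<in> J \<Longrightarrow> sc_analytic_on (\<xi> j) P" "\<And>j. j \<in> J \<Longrightarrow> sc_analytic_on (\<beta> j) P"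
  shows "sc_analytic_on (\<lambda>t. multiplier J (\<lambda>j. \<beta> j t) (\<lambda>j. \<xi> j t) p q) P"
proof -
  have "sc_analytic_on (\<lambda>t. Ln (local_factor p (\<xi> j t) q)) P" if j: "j \<in> J" for j
  proof (rule sc_analytic_on_chain[where \<phi> = "\<lambda>x. Ln (local_factor p x q)", OF an(1)[OF j]])
    fix t assume t: "t \<in> P"
    have pos: "local_factor p (\<xi> j t) q \<notin> \<real>\<^sub>\<le>\<^sub>0"
      using local_factor_pos[OF sub \<xi>[OF j t] q] by (rule Re_pos_notin_nonpos_Reals)
    have "\<exists>d. ((\<lambda>x. local_factor p x q) has_field_derivative d) (at (\<xi> j t))"
    proof (cases q)
      case Infty
      then show ?thesis by (auto intro!: exI[of _ 0])
    next
      case q': (Fin x)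
      show ?thesis
      proof (cases p)
        case Infty
        then have "x \<noteq> 0"
          using q q' by (auto simp: chart_Infty_def split: if_splits)
        then show ?thesis
          using q' Infty by (auto intro!: derivative_eq_intros exI[of _ "- 1 / x"])
      next
        case (Fin a)
        then have "a \<noteq> \<xi> j t"
          using sub centre_in_chart_ball[OF q] \<xi>[OF j t] by auto
        then show ?thesis
          using q' Fin by (auto intro!: derivative_eq_intros exI)
      qed
    qed
    then obtain d where "((\<lambda>x. local_factor p x q) has_field_derivative d) (at (\<xi> j t))" ..
    from DERIV_chain2[OF has_field_derivative_Ln[OF pos] this]
    show "\<exists>d. ((\<lambda>x. Ln (local_factor p x q)) has_field_derivative d) (at (\<xi> j t))" by blast
  qed
  then have "sc_analytic_on (\<lambda>t. \<Sum>j\<in>J. \<beta> j t * Ln (local_factor p (\<xi> j t) q)) P"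
    by (intro sc_analytic_on_sum sc_analytic_on_mult an(2))
  then show ?thesis
    unfolding multiplier_def
    by (rule sc_analytic_on_chain[where \<phi> = exp]) (auto intro: DERIV_exp)
qed

section \<open>Scalar matrices\<close>

lemma mat_nth: "(mat c :: 'a::zero^'n^'n) $ k $ l = (if k = l then c else 0)"
  by (simp add: mat_def)

lemma mat_mult_nth:
  fixes M :: "complex^'n^'n"
  shows "(mat c ** M) $ k $ l = c * M $ k $ l"
proof -
  have "(\<Sum>i\<in>UNIV. (if k = i then c else 0) * M $ i $ l) = (\<Sum>i\<in>UNIV. if k = i then c * M $ i $ l else 0)"
    by (intro sum.cong) auto
  then show ?thesis
    by (simp add: matrix_matrix_mult_def mat_nth)
qed

lemma mult_mat_nth:
  fixes M :: "complex^'n^'n"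
  shows "(M ** mat c) $ k $ l = M $ k $ l * c"
proof -
  have "(\<Sum>i\<in>UNIV. M $ k $ i * (if i = l then c else 0)) = (\<Sum>i\<in>UNIV. if i = l then M $ k $ i * c else 0)"
    by (intro sum.cong) auto
  then show ?thesis
    by (simp add: matrix_matrix_mult_def mat_nth)
qed

lemma mat_mult_mat: "(mat c ** mat d :: complex^'n^'n) = mat (c * d)"
  by (simp add: vec_eq_iff mat_mult_nth) (simp add: mat_nth)

text \<open>On a short piece of the path one solution \<open>\<sigma> (g s)\<close> covers all
  points and is a constant multiple of each \<open>\<sigma> (g u)\<close> near \<open>g u\<close>.
  The ratios of these constants are analytic in t and multiply along a subdivision. The scalars are
  wrapped in \<open>mat\<close> so that the result can be multiplied with matrix solutions.\<close>

lemma multiplier_transport: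
  fixes J :: "nat set" and \<beta> \<xi> :: "nat \<Rightarrow> complex^'r \<Rightarrow> complex" and g :: "real \<Rightarrow> riemann_sphere"
  defines "\<sigma> \<equiv> \<lambda>p t. multiplier J (\<lambda>j. \<beta> j t) (\<lambda>j. \<xi> j t) p"
  assumes D: "open D"
    and g: "continuous_on {0..1} g" "g ` {0..1} \<subseteq> D"
    and \<xi>: "\<And>j t. j \<in> J \<Longrightarrow> t \<in> P \<Longrightarrow> Fin (\<xi> j t) \<notin> D"
    and \<beta>: "\<And>t. Infty \<in> D \<Longrightarrow> t \<in> P \<Longrightarrow> (\<Sum>j\<in>J. \<beta> j t) = 0"
    and an: "\<And>j. j \<in> J \<Longrightarrow> sc_analytic_on (\<xi> j) P" "\<And>j. j \<in> J \<Longrightarrow> sc_analytic_on (\<beta> j) P"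
  obtains \<mu> where "sc_analytic_on \<mu> P" "\<And>t. t \<in> P \<Longrightarrow> \<mu> t \<noteq> 0"
    "\<And>t. t \<in> P \<Longrightarrow> continues_along g (\<lambda>q. mat (\<sigma> (g 0) t q) :: complex^'n^'n)
       (\<lambda>q. mat (\<mu> t * \<sigma> (g 1) t q))"
proof -
  \<comment> \<open>One \<mu> is required for all t at once: the disks lie in D, which no pole
    enters, so a subdivision suits every parameter.\<close>
  define R where "R a b \<longleftrightarrow> (\<exists>\<mu>. sc_analytic_on \<mu> P \<and> (\<forall>t\<in>P. \<mu> t \<noteq> 0 \<and>
      continues_between a b g (\<lambda>q. mat (\<sigma> (g a) t q) :: complex^'n^'n)
        (\<lambda>q. mat (\<mu> t * \<sigma> (g b) t q))))" for a b
  have "R 0 1"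
  proof (rule Bolzano_interval[of 0 1])
    fix u v w :: real
    assume R: "R u v" "R v w" and uvw: "0 \<le> u" "u \<le> v" "v \<le> w" "w \<le> 1"
    obtain \<mu> where \<mu>: "sc_analytic_on \<mu> P" "\<forall>t\<in>P. \<mu> t \<noteq> 0 \<and>
      continues_between u v g (\<lambda>q. mat (\<sigma> (g u) t q) :: complex^'n^'n) (\<lambda>q. mat (\<mu> t * \<sigma> (g v) t q))"
      using R(1) unfolding R_def by blast
    obtain \<nu> where \<nu>: "sc_analytic_on \<nu> P" "\<forall>t\<in>P. \<nu> t \<noteq> 0 \<and>
      continues_between v w g (\<lambda>q. mat (\<sigma> (g v) t q) :: complex^'n^'n) (\<lambda>q. mat (\<nu> t * \<sigma> (g w) t q))"
      using R(2) unfolding R_def by blast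
    have "continues_between u w g (\<lambda>q. mat (\<sigma> (g u) t q) :: complex^'n^'n)
        (\<lambda>q. mat (\<mu> t * \<nu> t * \<sigma> (g w) t q))" if t: "t \<in> P" for t
    proof (rule continues_between_trans)
      show "continues_between u v g (\<lambda>q. mat (\<sigma> (g u) t q) :: complex^'n^'n)
          (\<lambda>q. mat (\<mu> t * \<sigma> (g v) t q))"
        using \<mu>(2) t by blast
      \<comment> \<open>Multiplying the second continuation by the constant \<open>\<mu> t\<close>
        makes it start where the first one ends.\<close>
      have "continues_between v w g (\<lambda>q. mat (\<mu> t) :: complex^'n^'n) (\<lambda>q. mat (\<mu> t))"
        by (intro continues_between_const sphere_analytic_at_mat sphere_analytic_const)
      from continues_between_mult[OF this \<nu>(2)[rule_format, OF t, THEN conjunct2]]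
      show "continues_between v w g (\<lambda>q. mat (\<mu> t * \<sigma> (g v) t q) :: complex^'n^'n)
          (\<lambda>q. mat (\<mu> t * \<nu> t * \<sigma> (g w) t q))"
        by (simp add: mat_mult_mat mult.assoc)
      show "continuous_on {u..w} g"
        using g(1) by (rule continuous_on_subset) (use uvw in auto)
    qed (use uvw in auto)
    then show "R u w"
      unfolding R_def using \<mu> \<nu> by (intro exI[of _ "\<lambda>t. \<mu> t * \<nu> t"]) (auto intro: sc_analytic_on_mult)
  next
    fix s :: real assume s: "s \<in> {0..1}"
    then have "g s \<in> D"
      using g(2) by auto
    then obtain r where r: "r > 0" "chart (g s) ` ball (centre (g s)) r \<subseteq> D" (is "?U \<subseteq> D")
      using chart_ball_subset[OF D] by blast
    have gs: "g s \<in> ?U"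
      using r(1) by (intro image_eqI[of _ _ "centre (g s)"]) auto
    have "(g \<longlongrightarrow> g s) (at s within {0..1})"
      using g s by (simp add: continuous_on_def)
    then have ev: "\<forall>\<^sub>F u in at s within {0..1}. g u \<in> ?U"
      using eventually_in_chart_ball[OF gs] unfolding filterlim_iff by blast
    have "R u v" if "u \<le> s" "s \<le> v" and U: "\<forall>w\<in>{u..v} - {s}. g w \<in> ?U" for u v
    proof -
      have U: "g w \<in> ?U" if "w \<in> {u..v}" for w
        using U gs that by (cases "w = s") auto
      have uv: "u \<in> {u..v}" "v \<in> {u..v}"
        using that by auto
      \<comment> \<open>Near \<open>g u\<close> and near \<open>g v\<close> the solution
        \<open>\<sigma> (g s)\<close> is its value there times the local solution; dividing the two
        values gives the transport factor.\<close>
      define \<mu> where "\<mu> t = \<sigma> (g s) t (g v) / \<sigma> (g s) t (g u)" for t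
      have "sc_analytic_on \<mu> P"
        unfolding \<mu>_def \<sigma>_def
        by (intro sc_analytic_on_divide multiplier_parameter_analytic[OF r(2) U] \<xi> an)
          (use uv in auto)
      moreover have "continues_between u v g (\<lambda>q. mat (\<sigma> (g u) t q) :: complex^'n^'n)
          (\<lambda>q. mat (\<mu> t * \<sigma> (g v) t q))" if t: "t \<in> P" for t
      proof (rule continues_between_cong)
        have coc: "\<forall>\<^sub>F q in nhds (g w). \<sigma> (g s) t q = \<sigma> (g s) t (g w) * \<sigma> (g w) t q"
          if "w \<in> {u..v}" for w
          unfolding \<sigma>_def by (rule multiplier_cocycle[OF D \<xi> \<beta> r(2) U[OF that]]) (use t in auto)
        have "sphere_analytic (\<lambda>q. 1 / \<sigma> (g s) t (g u) * \<sigma> (g s) t q) (g w)" if "w \<in> {u..v}" for w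
          unfolding \<sigma>_def
          by (intro sphere_analytic_mult sphere_analytic_const
              multiplier_analytic[OF D \<xi> \<beta> r(2) U[OF that]]) (use t in auto)
        then show "continues_between u v g
            (\<lambda>q. mat (1 / \<sigma> (g s) t (g u) * \<sigma> (g s) t q) :: complex^'n^'n)
            (\<lambda>q. mat (1 / \<sigma> (g s) t (g u) * \<sigma> (g s) t q))"
          by (intro continues_between_const sphere_analytic_at_mat)
        show "\<forall>\<^sub>F q in nhds (g u).
            (mat (1 / \<sigma> (g s) t (g u) * \<sigma> (g s) t q) :: complex^'n^'n) = mat (\<sigma> (g u) t q)"
          using coc[OF uv(1)] by eventually_elim (simp add: \<sigma>_def)
        show "\<forall>\<^sub>F q in nhds (g v).
            (mat (1 / \<sigma> (g s) t (g u) * \<sigma> (g s) t q) :: complex^'n^'n) = mat (\<mu> t * \<sigma> (g v) t q)"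
          using coc[OF uv(2)] by eventually_elim (simp add: \<mu>_def)
      qed
      moreover have "\<mu> t \<noteq> 0" for t
        by (simp add: \<mu>_def \<sigma>_def)
      ultimately show "R u v"
        unfolding R_def by blast
    qed
    with ev show "\<exists>Q. eventually Q (at s within {0..1}) \<and>
      (\<forall>u v. 0 \<le> u \<longrightarrow> u \<le> s \<longrightarrow> s \<le> v \<longrightarrow> v \<le> 1 \<longrightarrow>
        (\<forall>w\<in>{u..v} - {s}. Q w) \<longrightarrow> R u v)"
      by (intro exI[of _ "\<lambda>u. g u \<in> ?U"]) blast
  qed simp
  then show thesis
    unfolding R_def continues_along_iff using that by (auto simp: continues_along_iff)
qed

subsection \<open>Liouville's formula\<close>

text \<open>Differentiating row by row gives determinants in which row i is replaced by a
  combination of the rows of \<open>W x\<close>. By multilinearity only the multiple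
  \<open>B $ i $ i\<close> of row i survives; all other terms have two equal rows.\<close>

lemma has_field_derivative_det:
  fixes W :: "complex \<Rightarrow> complex^'n^'n"
  assumes W: "\<And>k l. ((\<lambda>z. W z $ k $ l) has_field_derivative (B ** W x) $ k $ l) (at x)"
  shows "((\<lambda>z. det (W z)) has_field_derivative trace B * det (W x)) (at x)"
proof -
  let ?P = "{p. p permutes (UNIV :: 'n set)}"
  have row: "det ((\<chi> r. if r = i then (B ** W x) $ i else W x $ r) :: complex^'n^'n) = B $ i $ i * det (W x)"
    for i
  proof -
    have "(B ** W x) $ i = (\<Sum>k\<in>UNIV. B $ i $ k *s W x $ k)"
      by (simp add: vec_eq_iff matrix_matrix_mult_def)
    then have "det ((\<chi> r. if r = i then (B ** W x) $ i else W x $ r) :: complex^'n^'n) =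
        det ((\<chi> r. if r = i then (\<Sum>k\<in>UNIV. B $ i $ k *s W x $ k) else W x $ r) :: complex^'n^'n)"
      by (simp only:)
    also have "\<dots> = (\<Sum>k\<in>UNIV. det ((\<chi> r. if r = i then B $ i $ k *s W x $ k else W x $ r) :: complex^'n^'n))"
      using det_linear_row_sum[of UNIV i "\<lambda>_ k. B $ i $ k *s W x $ k" "\<lambda>r. W x $ r"] by (simp only: finite)
    also have "\<dots> = (\<Sum>k\<in>UNIV. B $ i $ k * det ((\<chi> r. if r = i then W x $ k else W x $ r) :: complex^'n^'n))"
      by (rule sum.cong[OF refl]) (rule det_row_mul[where a = "\<lambda>_. W x $ _" and b = "\<lambda>r. W x $ r"])
    also have "\<dots> = (\<Sum>k\<in>UNIV. if k = i then B $ i $ i * det (W x) else 0)"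
    proof (rule sum.cong)
      fix k
      show "B $ i $ k * det ((\<chi> r. if r = i then W x $ k else W x $ r) :: complex^'n^'n) =
          (if k = i then B $ i $ i * det (W x) else 0)"
      proof (cases "k = i")
        case True
        then have "((\<chi> r. if r = i then W x $ k else W x $ r) :: complex^'n^'n) = W x"
          by (simp add: vec_eq_iff)
        then show ?thesis
          using True by simp
      next
        case False
        then have "det ((\<chi> r. if r = i then W x $ k else W x $ r) :: complex^'n^'n) = 0"
          by (intro det_identical_rows[of i k]) (auto simp: row_def vec_eq_iff)
        then show ?thesis
          using False by simp
      qed
    qed simp
    finally show ?thesis by simp
  qed
  have "((\<lambda>z. det (W z)) has_field_derivative
      (\<Sum>p\<in>?P. of_int (sign p) * (\<Sum>i\<in>UNIV. (B ** W x) $ i $ p i * (\<Prod>j\<in>UNIV - {i}. W x $ j $ p j))))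
      (at x)"
    unfolding det_def by (intro DERIV_sum DERIV_cmult has_field_derivative_prod W)
  also have "(\<Sum>p\<in>?P. of_int (sign p) * (\<Sum>i\<in>UNIV. (B ** W x) $ i $ p i * (\<Prod>j\<in>UNIV - {i}. W x $ j $ p j))) =
      (\<Sum>i\<in>UNIV. \<Sum>p\<in>?P. of_int (sign p) * ((B ** W x) $ i $ p i * (\<Prod>j\<in>UNIV - {i}. W x $ j $ p j)))"
    unfolding sum_distrib_left by (rule sum.swap)
  also have "\<dots> = (\<Sum>i\<in>UNIV. det ((\<chi> r. if r = i then (B ** W x) $ i else W x $ r) :: complex^'n^'n))"
    unfolding det_def
  proof (intro sum.cong refl arg_cong2[where f = "(*)"])
    fix i :: 'n and p :: "'n \<Rightarrow> 'n"
    have "(\<Prod>j\<in>UNIV. (if j = i then (B ** W x) $ i else W x $ j) $ p j) =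
        (B ** W x) $ i $ p i * (\<Prod>j\<in>UNIV - {i}. (if j = i then (B ** W x) $ i else W x $ j) $ p j)"
      by (subst prod.remove[of UNIV i]) auto
    also have "(\<Prod>j\<in>UNIV - {i}. (if j = i then (B ** W x) $ i else W x $ j) $ p j) =
        (\<Prod>j\<in>UNIV - {i}. W x $ j $ p j)"
      by (intro prod.cong) auto
    finally show "(B ** W x) $ i $ p i * (\<Prod>j\<in>UNIV - {i}. W x $ j $ p j) =
        (\<Prod>j\<in>UNIV. (\<chi> r. if r = i then (B ** W x) $ i else W x $ r) $ j $ p j)"
      by simp
  qed
  also have "\<dots> = trace B * det (W x)"
    unfolding row by (simp add: trace_def sum_distrib_right)
  finally show ?thesis .
qed

text \<open>Zero derivative in x means zero derivative in w = 1/x by the chain rule. A disk is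
  connected, so f is constant in the chart.\<close>

lemma sphere_analytic_eventually_const:
  assumes an: "sphere_analytic f p"
    and der: "\<forall>\<^sub>F q in nhds p. \<forall>x. q = Fin x \<longrightarrow>
      ((\<lambda>z. f (Fin z)) has_field_derivative 0) (at x)"
  obtains c where "\<forall>\<^sub>F q in nhds p. f q = c"
proof -
  let ?h = "\<lambda>z. f (chart p z)"
  have "\<forall>\<^sub>F z in nhds (centre p). \<forall>x. chart p z = Fin x \<longrightarrow>
      ((\<lambda>z. f (Fin z)) has_field_derivative 0) (at x)"
    using der unfolding nhds_eq_filtermap_chart[of p] eventually_filtermap .
  then obtain r where r: "r > 0" "\<And>z x. dist z (centre p) < r \<Longrightarrow> chart p z = Fin x \<Longrightarrow>
      ((\<lambda>z. f (Fin z)) has_field_derivative 0) (at x)"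
    unfolding eventually_nhds_metric by blast
  obtain r' where r': "r' > 0" "?h holomorphic_on ball (centre p) r'"
    using an unfolding sphere_analytic_def analytic_at_ball by blast
  define e where "e = min r r'"
  have "?h holomorphic_on ball (centre p) e"
    using r'(2) by (rule holomorphic_on_subset) (auto simp: e_def)
  then have cont: "continuous_on (ball (centre p) e) ?h"
    by (rule holomorphic_on_imp_continuous_on)
  \<comment> \<open>The centre is left out, since at \<open>Infty\<close> the hypothesis is silent;
    continuity there is enough for the connectedness argument.\<close>
  have "(?h has_field_derivative 0) (at z)" if z: "z \<in> ball (centre p) e - {centre p}" for z
  proof (cases p)
    case (Fin a)
    then show ?thesis
      using r(2)[of z z] z by (simp add: e_def dist_commute)
  next
    case Infty
    then have z0: "z \<noteq> 0"
      using z by simp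
    have "((\<lambda>x. f (Fin x)) has_field_derivative 0) (at (1 / z))"
      using z z0 Infty by (intro r(2)[of z]) (auto simp: e_def chart_Infty_def)
    moreover have "((\<lambda>w. 1 / w) has_field_derivative (- 1 / z\<^sup>2)) (at z)"
      using z0 by (auto intro!: derivative_eq_intros simp: power2_eq_square)
    ultimately have "((\<lambda>w. f (Fin (1 / w))) has_field_derivative 0 * (- 1 / z\<^sup>2)) (at z)"
      by (rule DERIV_chain2)
    then have "((\<lambda>w. f (Fin (1 / w))) has_field_derivative 0) (at z)"
      by simp
    then show ?thesis
      using z0 Infty
      by (elim has_field_derivative_transform_within_open[where S = "- {0}"]) (auto simp: chart_Infty_def)
  qed
  then obtain c where c: "\<And>z. z \<in> ball (centre p) e \<Longrightarrow> ?h z = c"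
    using DERIV_zero_connected_constant[of "ball (centre p) e" "{centre p}" ?h] cont by auto
  have "e > 0"
    using r(1) r'(1) by (simp add: e_def)
  then have "\<forall>\<^sub>F z in nhds (centre p). z \<in> ball (centre p) e"
    by (intro eventually_nhds_in_open) auto
  then have "\<forall>\<^sub>F q in nhds p. f q = c"
    unfolding nhds_eq_filtermap_chart[of p] eventually_filtermap
    by eventually_elim (rule c)
  then show thesis by (rule that)
qed

text \<open>The traceless case of Liouville's formula; the constant is nonzero because
  \<open>Y p\<close> is invertible.\<close>

lemma fundamental_solution_det_const:
  assumes Y: "fundamental_solution_at A p Y" and A: "\<And>x. trace (A x) = 0"
  obtains c where "c \<noteq> 0" "\<forall>\<^sub>F q in nhds p. det (Y q) = c"
proof -
  have ev: "\<forall>\<^sub>F q in nhds p. invertible (Y q) \<and> (\<forall>x. q = Fin x \<longrightarrow>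
      (\<forall>k l. ((\<lambda>z. Y (Fin z) $ k $ l) has_field_derivative (A x ** Y (Fin x)) $ k $ l) (at x)))"
    and an: "sphere_analytic_at Y p"
    using Y unfolding fundamental_solution_at_def by auto
  from ev have "\<forall>\<^sub>F q in nhds p. \<forall>x. q = Fin x \<longrightarrow>
      ((\<lambda>z. det (Y (Fin z))) has_field_derivative 0) (at x)"
  proof eventually_elim
    case (elim q)
    show ?case
    proof (intro allI impI)
      fix x assume "q = Fin x"
      with elim have "((\<lambda>z. det (Y (Fin z))) has_field_derivative trace (A x) * det (Y (Fin x))) (at x)"
        by (intro has_field_derivative_det) auto
      then show "((\<lambda>z. det (Y (Fin z))) has_field_derivative 0) (at x)"
        using A by simp
    qed
  qed
  from sphere_analytic_eventually_const[OF sphere_analytic_det[OF an] this]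
  obtain c where c: "\<forall>\<^sub>F q in nhds p. det (Y q) = c" .
  have "det (Y p) = c" "invertible (Y p)"
    using eventually_nhds_x_imp_x[OF c] eventually_nhds_x_imp_x[OF ev] by auto
  then show thesis
    using that c invertible_det_nz by blast
qed

subsection \<open>Equations differing by a scalar term\<close>

lemma matrix_add_rdistrib:
  fixes A B :: "'a::semiring_1^'m^'n"
  shows "(A + B) ** C = A ** C + B ** C"
  by (simp add: vec_eq_iff matrix_matrix_mult_def distrib_right sum.distrib)

text \<open>The product rule: \<omega> is the logarithmic derivative of s and adds a scalar term to
  the coefficient.\<close>

lemma fundamental_solution_scalar_mult:
  assumes Y: "fundamental_solution_at A p Y"
    and s: "sphere_analytic s p" "\<And>q. s q \<noteq> 0"
      "\<forall>\<^sub>F q in nhds p. \<forall>x. q = Fin x \<longrightarrow>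
        ((\<lambda>z. s (Fin z)) has_field_derivative \<omega> x * s (Fin x)) (at x)"
  shows "fundamental_solution_at (\<lambda>x. A x + mat (\<omega> x)) p (\<lambda>q. Y q ** mat (s q))"
  unfolding fundamental_solution_at_def
proof
  show "sphere_analytic_at (\<lambda>q. Y q ** mat (s q)) p"
    using Y s(1) unfolding fundamental_solution_at_def
    by (intro sphere_analytic_at_mult sphere_analytic_at_mat) auto
  have "\<forall>\<^sub>F q in nhds p. invertible (Y q) \<and> (\<forall>x. q = Fin x \<longrightarrow>
      (\<forall>k l. ((\<lambda>z. Y (Fin z) $ k $ l) has_field_derivative (A x ** Y (Fin x)) $ k $ l) (at x)))"
    using Y unfolding fundamental_solution_at_def by auto
  then show "\<forall>\<^sub>F q in nhds p. invertible (Y q ** mat (s q)) \<and> (\<forall>x. q = Fin x \<longrightarrow>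
      (\<forall>k l. ((\<lambda>z. (Y (Fin z) ** mat (s (Fin z))) $ k $ l) has_field_derivative
        ((A x + mat (\<omega> x)) ** (Y (Fin x) ** mat (s (Fin x)))) $ k $ l) (at x)))"
    using s(3)
  proof eventually_elim
    case (elim q)
    have "mat (s q) ** mat (1 / s q) = (mat 1 :: complex^'a^'a)"
      "mat (1 / s q) ** mat (s q) = (mat 1 :: complex^'a^'a)"
      using s(2)[of q] by (simp_all add: mat_mult_mat)
    then have "invertible (mat (s q) :: complex^'a^'a)"
      unfolding invertible_def by blast
    then have "invertible (Y q ** mat (s q))"
      using elim(1) by (auto intro: invertible_mult)
    moreover have "((\<lambda>z. (Y (Fin z) ** mat (s (Fin z))) $ k $ l) has_field_derivative
        ((A x + mat (\<omega> x)) ** (Y (Fin x) ** mat (s (Fin x)))) $ k $ l) (at x)"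
      if x: "q = Fin x" for x k l
    proof -
      have "((\<lambda>z. Y (Fin z) $ k $ l * s (Fin z)) has_field_derivative
          (A x ** Y (Fin x)) $ k $ l * s (Fin x) + \<omega> x * s (Fin x) * Y (Fin x) $ k $ l) (at x)"
        using elim x by (intro DERIV_mult) auto
      moreover have "((A x + mat (\<omega> x)) ** (Y (Fin x) ** mat (s (Fin x)))) $ k $ l =
          (A x ** Y (Fin x)) $ k $ l * s (Fin x) + \<omega> x * s (Fin x) * Y (Fin x) $ k $ l"
        by (simp add: matrix_add_rdistrib mat_mult_nth mult_mat_nth matrix_mul_assoc algebra_simps)
      ultimately show ?thesis
        by (simp add: mult_mat_nth)
    qed
    ultimately show ?case by blast
  qed
qed

lemma fuchsian_add_scalar:
  fixes A B :: "nat \<Rightarrow> complex^'r \<Rightarrow> complex^'n^'n"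
  assumes "\<And>j. j \<in> {1..m} \<Longrightarrow> B j t = A j t + mat (\<beta> j t)"
  shows "fuchsian m B \<xi> x t = fuchsian m A \<xi> x t + mat (\<Sum>j\<in>{1..m}. \<beta> j t / (x - \<xi> j t))"
proof -
  have "fuchsian m B \<xi> x t $ k $ l =
      fuchsian m A \<xi> x t $ k $ l + (mat (\<Sum>j\<in>{1..m}. \<beta> j t / (x - \<xi> j t)) :: complex^'n^'n) $ k $ l" for k l
    using assms by (simp add: fuchsian_def mat_mult_nth mat_nth distrib_left sum.distrib)
  then show ?thesis
    by (simp add: vec_eq_iff)
qed

lemma trace_fuchsian:
  "trace (fuchsian m A \<xi> x t) = (\<Sum>j\<in>{1..m}. trace (A j t) / (x - \<xi> j t))"
proof -
  have "trace (fuchsian m A \<xi> x t) = (\<Sum>k\<in>UNIV. \<Sum>j\<in>{1..m}. A j t $ k $ k / (x - \<xi> j t))"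
    by (simp add: trace_def fuchsian_def mat_mult_nth)
  also have "\<dots> = (\<Sum>j\<in>{1..m}. trace (A j t) / (x - \<xi> j t))"
    by (subst sum.swap) (simp add: trace_def sum_divide_distrib)
  finally show ?thesis .
qed

text \<open>In the coordinate w = 1/x, the sum of A j / (1 - w \<xi> j) equals -w C(w, t) off w = 0.
  As w tends to 0 the former tends to the sum of the residues and the latter to 0, C being
  continuous.\<close>

lemma analytic_equation_sum_residues:
  fixes A :: "nat \<Rightarrow> complex^'r \<Rightarrow> complex^'n^'n"
  assumes "analytic_equation D P (fuchsian m A \<xi>)" and D: "open D" "Infty \<in> D" and t: "t \<in> P"
  shows "(\<Sum>j\<in>{1..m}. A j t) = 0"
proof -
  obtain C where C: "mat_analytic_on_Times C (chart_Infty -` D) P"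
    "\<And>w. w \<in> chart_Infty -` D - {0} \<Longrightarrow> C w t = mat (- 1 / w\<^sup>2) ** fuchsian m A \<xi> (1 / w) t"
    using assms unfolding analytic_equation_def by blast
  have "(\<Sum>j\<in>{1..m}. A j t $ k $ l) = 0" for k l
  proof -
    have "0 \<in> chart_Infty -` D"
      using D by (simp add: chart_Infty_def)
    then obtain a v where "((\<lambda>(y, s). C y s $ k $ l) has_derivative
        (\<lambda>(h, d). a * h + (\<Sum>j\<in>UNIV. v $ j * d $ j))) (at (0, t))"
      using C(1) t unfolding mat_analytic_on_Times_def by blast
    then have "isCont (\<lambda>(y, s). C y s $ k $ l) (0, t)"
      by (rule has_derivative_continuous)
    moreover have "((\<lambda>w. (w, t)) \<longlongrightarrow> (0, t)) (at 0)"
      by (intro tendsto_intros)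
    ultimately have "((\<lambda>w. (\<lambda>(y, s). C y s $ k $ l) (w, t)) \<longlongrightarrow> (\<lambda>(y, s). C y s $ k $ l) (0, t)) (at 0)"
      by (rule isCont_tendsto_compose)
    then have "((\<lambda>w. C w t $ k $ l) \<longlongrightarrow> C 0 t $ k $ l) (at 0)"
      by (simp only: prod.case)
    then have "((\<lambda>w. - w * C w t $ k $ l) \<longlongrightarrow> - 0 * C 0 t $ k $ l) (at 0)"
      by (intro tendsto_mult tendsto_minus tendsto_ident_at)
    then have "((\<lambda>w. - w * C w t $ k $ l) \<longlongrightarrow> 0) (at 0)"
      by (simp only: minus_zero mult_zero_left)
    moreover have "\<forall>\<^sub>F w in at 0. - w * C w t $ k $ l = (\<Sum>j\<in>{1..m}. A j t $ k $ l / (1 - w * \<xi> j t))"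
    proof -
      obtain r where r: "r > 0" "chart_Infty ` ball 0 r \<subseteq> D"
        using chart_ball_subset[OF D] by auto
      have "\<forall>\<^sub>F w in at (0::complex). w \<in> ball 0 r"
        using r(1) by (intro eventually_at_in_open') auto
      moreover have "\<forall>\<^sub>F w in at (0::complex). w \<noteq> 0"
        by (simp add: eventually_at_filter)
      ultimately show ?thesis
      proof eventually_elim
        case (elim w)
        then have "C w t = mat (- 1 / w\<^sup>2) ** fuchsian m A \<xi> (1 / w) t"
          using r(2) by (intro C(2)) auto
        then have "- w * C w t $ k $ l = 1 / w * (\<Sum>j\<in>{1..m}. A j t $ k $ l / (1 / w - \<xi> j t))"
          using elim(2) by (simp add: mat_mult_nth fuchsian_def power2_eq_square)
        also have "\<dots> = (\<Sum>j\<in>{1..m}. A j t $ k $ l / (1 - w * \<xi> j t))"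
          unfolding sum_distrib_left
        proof (rule sum.cong)
          fix j
          have "1 - w * \<xi> j t = w * (1 / w - \<xi> j t)"
            using elim(2) by (simp add: right_diff_distrib)
          then show "1 / w * (A j t $ k $ l / (1 / w - \<xi> j t)) = A j t $ k $ l / (1 - w * \<xi> j t)"
            by simp
        qed simp
        finally show ?case .
      qed
    qed
    ultimately have "((\<lambda>w. \<Sum>j\<in>{1..m}. A j t $ k $ l / (1 - w * \<xi> j t)) \<longlongrightarrow> 0) (at 0)"
      by (rule Lim_transform_eventually)
    moreover have "((\<lambda>w. \<Sum>j\<in>{1..m}. A j t $ k $ l / (1 - w * \<xi> j t)) \<longlongrightarrow>
        (\<Sum>j\<in>{1..m}. A j t $ k $ l / (1 - 0 * \<xi> j t))) (at 0)"
      by (intro tendsto_intros) auto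
    ultimately have "0 = (\<Sum>j\<in>{1..m}. A j t $ k $ l / (1 - 0 * \<xi> j t))"
      by (rule LIM_unique)
    then show ?thesis by simp
  qed
  then show ?thesis
    by (simp add: vec_eq_iff)
qed

text \<open>The condition that \<open>mat_analytic_on_Times\<close> imposes on one entry at one
  point, isolated so that closure rules can be stated for it.\<close>

definition jointly_analytic_at :: "(complex \<times> (complex^'r) \<Rightarrow> complex) \<Rightarrow> complex \<times> (complex^'r) \<Rightarrow> bool" where
  "jointly_analytic_at f z \<longleftrightarrow>
     (\<exists>a v. (f has_derivative (\<lambda>(h, d). a * h + (\<Sum>j\<in>UNIV. v $ j * d $ j))) (at z))"

lemma mat_analytic_on_Times_iff:
  "mat_analytic_on_Times F W P \<longleftrightarrow>
     (\<forall>x\<in>W. \<forall>t\<in>P. \<forall>k l. jointly_analytic_at (\<lambda>z. F (fst z) (snd z) $ k $ l) (x, t))"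
  by (simp add: mat_analytic_on_Times_def jointly_analytic_at_def case_prod_beta')

lemma jointly_analytic_at_const [simp]: "jointly_analytic_at (\<lambda>_. c) z"
  unfolding jointly_analytic_at_def by (intro exI[of _ 0]) (simp add: case_prod_beta')

lemma jointly_analytic_at_add:
  assumes "jointly_analytic_at f z" "jointly_analytic_at g z"
  shows "jointly_analytic_at (\<lambda>z. f z + g z) z"
proof -
  obtain a v b w where
    "(f has_derivative (\<lambda>(h, d). a * h + (\<Sum>j\<in>UNIV. v $ j * d $ j))) (at z)"
    "(g has_derivative (\<lambda>(h, d). b * h + (\<Sum>j\<in>UNIV. w $ j * d $ j))) (at z)"
    using assms unfolding jointly_analytic_at_def by blast
  from has_derivative_add[OF this]
  have "((\<lambda>z. f z + g z) has_derivative
      (\<lambda>(h, d). (a + b) * h + (\<Sum>j\<in>UNIV. (v + w) $ j * d $ j))) (at z)"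
    by (simp add: case_prod_beta' sum.distrib algebra_simps)
  then show ?thesis
    unfolding jointly_analytic_at_def by blast
qed

lemma jointly_analytic_at_cmult:
  assumes "jointly_analytic_at f z"
  shows "jointly_analytic_at (\<lambda>z. c * f z) z"
proof -
  obtain a v where
    "(f has_derivative (\<lambda>(h, d). a * h + (\<Sum>j\<in>UNIV. v $ j * d $ j))) (at z)"
    using assms unfolding jointly_analytic_at_def by blast
  from has_derivative_mult_right[OF this, of c]
  have "((\<lambda>z. c * f z) has_derivative
      (\<lambda>(h, d). (c * a) * h + (\<Sum>j\<in>UNIV. (c *s v) $ j * d $ j))) (at z)"
    by (simp add: case_prod_beta' sum_distrib_left algebra_simps)
  then show ?thesis
    unfolding jointly_analytic_at_def by blast
qed

lemma jointly_analytic_at_sum: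
  "(\<And>i. i \<in> I \<Longrightarrow> jointly_analytic_at (f i) z) \<Longrightarrow> jointly_analytic_at (\<lambda>z. \<Sum>i\<in>I. f i z) z"
  by (induction I rule: infinite_finite_induct) (simp_all add: jointly_analytic_at_add)

text \<open>Every new entry is a linear combination of entries of F with constant
  coefficients.\<close>

lemma mat_analytic_on_Times_add_trace:
  fixes F :: "complex \<Rightarrow> complex^'r \<Rightarrow> complex^'n^'n"
  assumes "mat_analytic_on_Times F W P"
  shows "mat_analytic_on_Times (\<lambda>x t. F x t + mat (c * trace (F x t))) W P"
  unfolding mat_analytic_on_Times_iff
proof (intro ballI allI)
  fix x t and k l :: 'n
  assume xt: "x \<in> W" "t \<in> P"
  have F: "jointly_analytic_at (\<lambda>z. F (fst z) (snd z) $ k $ l) (x, t)" for k l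
    using assms xt unfolding mat_analytic_on_Times_iff by blast
  have "jointly_analytic_at (\<lambda>z. F (fst z) (snd z) $ k $ l +
      (if k = l then c else 0) * (\<Sum>i\<in>UNIV. F (fst z) (snd z) $ i $ i)) (x, t)"
    by (intro jointly_analytic_at_add jointly_analytic_at_cmult jointly_analytic_at_sum F)
  then show "jointly_analytic_at (\<lambda>z. (F (fst z) (snd z) + mat (c * trace (F (fst z) (snd z)))) $ k $ l) (x, t)"
    by (cases "k = l") (simp_all add: mat_nth trace_def)
qed

text \<open>Adding a multiple of the trace is a linear operation on matrices, so it commutes with
  the factor -1/w^2 and is applied to the coefficient C at infinity as well.\<close>

lemma analytic_equation_add_trace:
  fixes A :: "complex \<Rightarrow> complex^'r \<Rightarrow> complex^'n^'n"
  assumes "analytic_equation D P A"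
  shows "analytic_equation D P (\<lambda>x t. A x t + mat (c * trace (A x t)))"
  unfolding analytic_equation_def
proof (intro conjI impI)
  show "mat_analytic_on_Times (\<lambda>x t. A x t + mat (c * trace (A x t))) (Fin -` D) P"
    using assms unfolding analytic_equation_def by (intro mat_analytic_on_Times_add_trace) simp
  assume "Infty \<in> D"
  then obtain C where C: "mat_analytic_on_Times C (chart_Infty -` D) P"
    "\<forall>w\<in>chart_Infty -` D - {0}. \<forall>t\<in>P. C w t = mat (- 1 / w\<^sup>2) ** A (1 / w) t"
    using assms unfolding analytic_equation_def by blast
  have "C w t + mat (c * trace (C w t)) = mat (- 1 / w\<^sup>2) ** (A (1 / w) t + mat (c * trace (A (1 / w) t)))"
    if "w \<in> chart_Infty -` D - {0}" "t \<in> P" for w t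
  proof -
    have Cw: "C w t = mat (- 1 / w\<^sup>2) ** A (1 / w) t"
      using C(2) that by blast
    have "trace (C w t) = - 1 / w\<^sup>2 * trace (A (1 / w) t)"
      unfolding Cw by (simp only: trace_def mat_mult_nth sum_distrib_left)
    then show ?thesis
      by (simp add: Cw vec_eq_iff mat_mult_nth mat_nth algebra_simps)
  qed
  then show "\<exists>C. mat_analytic_on_Times C (chart_Infty -` D) P \<and>
      (\<forall>w\<in>chart_Infty -` D - {0}. \<forall>t\<in>P.
        C w t = mat (- 1 / w\<^sup>2) ** (A (1 / w) t + mat (c * trace (A (1 / w) t))))"
    using mat_analytic_on_Times_add_trace[OF C(1), of c] by blast
qed

text \<open>Both directions of the equivalence use this shift, with the roles of A and B exchanged.
  The factors \<mu> come from the scalar equation alone and are chosen before Y and M, so they serve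
  every solution and every monodromy matrix.\<close>

lemma scalar_shift:
  fixes A B :: "nat \<Rightarrow> complex^'r \<Rightarrow> complex^'n^'n"
  assumes D: "open D" "x0 \<in> D" and \<gamma>: "\<And>i. i \<in> I \<Longrightarrow> \<gamma> i \<in> loops_at D x0"
    and \<xi>: "\<And>j t. j \<in> {1..m} \<Longrightarrow> t \<in> P \<Longrightarrow> Fin (\<xi> j t) \<notin> D"
    and an: "\<And>j. j \<in> {1..m} \<Longrightarrow> sc_analytic_on (\<xi> j) P"
      "\<And>j. j \<in> {1..m} \<Longrightarrow> sc_analytic_on (\<beta> j) P"
    and \<beta>: "\<And>t. Infty \<in> D \<Longrightarrow> t \<in> P \<Longrightarrow> (\<Sum>j\<in>{1..m}. \<beta> j t) = 0"
    and AB: "\<And>j t. j \<in> {1..m} \<Longrightarrow> t \<in> P \<Longrightarrow> B j t = A j t + mat (\<beta> j t)"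
  shows "\<exists>\<mu>. (\<forall>i\<in>I. sc_analytic_on (\<mu> i) P \<and> (\<forall>t\<in>P. \<mu> i t \<noteq> 0)) \<and>
    (\<forall>t\<in>P. \<forall>Y. fundamental_solution_at (\<lambda>x. fuchsian m A \<xi> x t) x0 Y \<longrightarrow>
      (\<exists>Z. fundamental_solution_at (\<lambda>x. fuchsian m B \<xi> x t) x0 Z \<and>
        (\<forall>i\<in>I. \<forall>M. continues_along (\<gamma> i) Y (\<lambda>q. Y q ** M) \<longrightarrow>
          continues_along (\<gamma> i) Z (\<lambda>q. Z q ** (M ** mat (\<mu> i t))))))"
proof -
  define \<sigma> where "\<sigma> t = multiplier {1..m} (\<lambda>j. \<beta> j t) (\<lambda>j. \<xi> j t) x0" for t
  have "\<exists>\<mu>. sc_analytic_on \<mu> P \<and> (\<forall>t\<in>P. \<mu> t \<noteq> 0 \<and>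
      continues_along (\<gamma> i) (\<lambda>q. mat (\<sigma> t q) :: complex^'n^'n) (\<lambda>q. mat (\<mu> t * \<sigma> t q)))"
    if i: "i \<in> I" for i
  proof -
    \<comment> \<open>A loop starts and ends at x0, so both end germs in
      \<open>multiplier_transport\<close> belong to the same \<open>\<sigma> t\<close>, and \<mu> is
      a monodromy factor.\<close>
    have g: "continuous_on {0..1} (\<gamma> i)" "\<gamma> i ` {0..1} \<subseteq> D" "\<gamma> i 0 = x0" "\<gamma> i 1 = x0"
      using \<gamma>[OF i]
      by (auto simp: loops_at_def path_def path_image_def pathstart_def pathfinish_def)
    show ?thesis
      using multiplier_transport[where J = "{1..m}" and g = "\<gamma> i" and \<beta> = \<beta> and \<xi> = \<xi> and P = P
          and 'n = 'n, OF D(1) g(1,2) \<xi> \<beta> an] g(3,4)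
      unfolding \<sigma>_def by metis
  qed
  then obtain \<mu> where \<mu>: "\<And>i. i \<in> I \<Longrightarrow> sc_analytic_on (\<mu> i) P"
    "\<And>i t. i \<in> I \<Longrightarrow> t \<in> P \<Longrightarrow> \<mu> i t \<noteq> 0"
    "\<And>i t. i \<in> I \<Longrightarrow> t \<in> P \<Longrightarrow>
      continues_along (\<gamma> i) (\<lambda>q. mat (\<sigma> t q) :: complex^'n^'n) (\<lambda>q. mat (\<mu> i t * \<sigma> t q))"
    by metis
  have "\<exists>Z. fundamental_solution_at (\<lambda>x. fuchsian m B \<xi> x t) x0 Z \<and>
      (\<forall>i\<in>I. \<forall>M. continues_along (\<gamma> i) Y (\<lambda>q. Y q ** M) \<longrightarrow>
        continues_along (\<gamma> i) Z (\<lambda>q. Z q ** (M ** mat (\<mu> i t))))"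
    if t: "t \<in> P" and Y: "fundamental_solution_at (\<lambda>x. fuchsian m A \<xi> x t) x0 Y" for t Y
  proof (intro exI[of _ "\<lambda>q. Y q ** mat (\<sigma> t q)"] conjI ballI allI impI)
    obtain r where r: "r > 0" "chart x0 ` ball (centre x0) r \<subseteq> D"
      using chart_ball_subset[OF D] by blast
    have "x0 \<in> chart x0 ` ball (centre x0) r"
      using r(1) by (intro image_eqI[of _ _ "centre x0"]) auto
    then have "sphere_analytic (\<sigma> t) x0"
      unfolding \<sigma>_def by (intro multiplier_analytic[OF D(1) _ _ r(2)] \<xi> \<beta> t)
    moreover have "\<sigma> t q \<noteq> 0" for q
      by (simp add: \<sigma>_def)
    moreover have "\<forall>\<^sub>F q in nhds x0. \<forall>x. q = Fin x \<longrightarrow> ((\<lambda>z. \<sigma> t (Fin z)) has_field_derivative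
        (\<Sum>j\<in>{1..m}. \<beta> j t / (x - \<xi> j t)) * \<sigma> t (Fin x)) (at x)"
      unfolding \<sigma>_def by (intro multiplier_has_field_derivative[OF D(1) _ _ D(2)] \<xi> \<beta> t)
    ultimately have "fundamental_solution_at
        (\<lambda>x. fuchsian m A \<xi> x t + mat (\<Sum>j\<in>{1..m}. \<beta> j t / (x - \<xi> j t))) x0 (\<lambda>q. Y q ** mat (\<sigma> t q))"
      by (rule fundamental_solution_scalar_mult[OF Y])
    then show "fundamental_solution_at (\<lambda>x. fuchsian m B \<xi> x t) x0 (\<lambda>q. Y q ** mat (\<sigma> t q))"
      by (simp only: fuchsian_add_scalar[of m B t A \<beta>, OF AB[OF _ t]])
    fix i M assume i: "i \<in> I" and Y_cont: "continues_along (\<gamma> i) Y (\<lambda>q. Y q ** M)"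
    have "continues_along (\<gamma> i) (\<lambda>q. Y q ** mat (\<sigma> t q))
        (\<lambda>q. (Y q ** M) ** mat (\<mu> i t * \<sigma> t q))"
      using Y_cont \<mu>(3)[OF i t] unfolding continues_along_iff by (rule continues_between_mult)
    moreover have "(Y q ** M) ** mat (\<mu> i t * \<sigma> t q) =
        (Y q ** mat (\<sigma> t q)) ** (M ** mat (\<mu> i t))" for q
    proof -
      \<comment> \<open>A scalar matrix commutes with M, so the scalar factor can be moved next to
        Y.\<close>
      have "mat (\<sigma> t q) ** M = M ** mat (\<sigma> t q)"
        by (simp add: vec_eq_iff mat_mult_nth mult_mat_nth)
      then have "(Y q ** mat (\<sigma> t q)) ** (M ** mat (\<mu> i t)) = Y q ** M ** (mat (\<sigma> t q) ** mat (\<mu> i t))"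
        by (metis matrix_mul_assoc)
      then show ?thesis
        by (simp add: mat_mult_mat mult.commute)
    qed
    ultimately show "continues_along (\<gamma> i) (\<lambda>q. Y q ** mat (\<sigma> t q))
        (\<lambda>q. (Y q ** mat (\<sigma> t q)) ** (M ** mat (\<mu> i t)))"
      by simp
  qed
  with \<mu>(1,2) show ?thesis
    by (intro exI[of _ \<mu>] conjI ballI allI impI) simp_all
qed

text \<open>The determinant of Z is a nonzero constant c near x0 and keeps this value along the
  loop, where it has become c times \<open>det M\<close>.\<close>

lemma det_monodromy_eq_1:
  assumes "\<gamma> \<in> loops_at D x0"
    and Z: "fundamental_solution_at A x0 Z" "\<And>x. trace (A x) = 0"
    and cont: "continues_along \<gamma> Z (\<lambda>q. Z q ** M)"
  shows "det M = 1"
proof -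
  have g: "continuous_on {0..1} \<gamma>" "\<gamma> 0 = x0" "\<gamma> 1 = x0"
    using assms(1) by (auto simp: loops_at_def path_def pathstart_def pathfinish_def)
  obtain c where c: "c \<noteq> 0" "\<forall>\<^sub>F q in nhds x0. det (Z q) = c"
    using fundamental_solution_det_const[OF Z] .
  then have "\<forall>\<^sub>F q in nhds x0. det (Z q ** M) = c"
    using continues_along_det_const[OF g(1) cont] g by simp
  with c(2) have "\<forall>\<^sub>F q in nhds x0. c * det M = c"
    by eventually_elim (simp add: det_mul)
  then show ?thesis
    using c(1) by simp
qed

lemma det_mat: "det (mat c :: complex^'n^'n) = c ^ CARD('n)"
  by (subst det_diagonal) (simp_all add: mat_nth)

lemma invertible_mat: "c \<noteq> 0 \<Longrightarrow> invertible (mat c :: complex^'n^'n)"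
  by (simp add: invertible_det_nz det_mat)

subsection \<open>Projective isomonodromy\<close>

theorem proposition7:
  fixes P :: "(complex^'r) set"
    and D :: "riemann_sphere set"
    and m :: nat
    and Dk :: "nat \<Rightarrow> riemann_sphere set"
    and x0 :: riemann_sphere
    and \<gamma> :: "nat \<Rightarrow> real \<Rightarrow> riemann_sphere"
    and A :: "nat \<Rightarrow> complex^'r \<Rightarrow> complex^'n^'n"
    and \<xi> :: "nat \<Rightarrow> complex^'r \<Rightarrow> complex"
  assumes "open P" and "simply_connected P"
    and "open D"
    and "\<forall>i\<in>{1..m}. closed_disk (Dk i)"
    and "disjoint_family_on Dk {1..m}"
    and "UNIV - D = (\<Union>i\<in>{1..m}. Dk i)"
    and "x0 \<in> D"
    and "usual_loops D m Dk x0 \<gamma>"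
    and "\<forall>i\<in>{1..m}. mat_analytic_on (A i) P"
    and "\<forall>i\<in>{1..m}. sc_analytic_on (\<xi> i) P"
    and "\<forall>i\<in>{1..m}. \<forall>t\<in>P. Fin (\<xi> i t) \<in> Dk i"
    and "analytic_equation D P (fuchsian m A \<xi>)"
  shows "projectively_isomonodromic D P x0 m \<gamma> (fuchsian m A \<xi>) \<longleftrightarrow>
    (\<exists>(b :: nat \<Rightarrow> complex^'r \<Rightarrow> complex^'n^'n) (B :: nat \<Rightarrow> complex^'r \<Rightarrow> complex^'n^'n).
      (\<forall>i\<in>{1..m}. mat_analytic_on (b i) P \<and> b i ` P \<subseteq> range mat \<and> mat_analytic_on (B i) P) \<and>
      (\<forall>i\<in>{1..m}. \<forall>t\<in>P. A i t = B i t + b i t) \<and>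
      isomonodromic D P x0 m \<gamma> (fuchsian m B \<xi>))"
proof -
  have loops: "\<gamma> i \<in> loops_at D x0" if "i \<in> {1..m}" for i
    using assms(8) that by (simp add: usual_loops_def)
  have \<xi>: "Fin (\<xi> j t) \<notin> D" if "j \<in> {1..m}" "t \<in> P" for j t
    using assms(6,11) that by blast
  have \<xi>_an: "sc_analytic_on (\<xi> j) P" if "j \<in> {1..m}" for j
    using assms(10) that by blast
  have A_an: "sc_analytic_on (\<lambda>t. A j t $ k $ l) P" if "j \<in> {1..m}" for j k l
    using assms(9) that by (simp add: mat_analytic_on_def)
  have mat_an: "mat_analytic_on (\<lambda>t. mat (f t) :: complex^'n^'n) P" if "sc_analytic_on f P" for f
    unfolding mat_analytic_on_def
  proof (intro allI)
    fix k l :: 'n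
    show "sc_analytic_on (\<lambda>t. (mat (f t) :: complex^'n^'n) $ k $ l) P"
      using that by (cases "k = l") (simp_all add: mat_nth)
  qed
  show ?thesis
  proof

    \<comment> \<open>From projective isomonodromy to the trace-free residues\<close>
    assume "projectively_isomonodromic D P x0 m \<gamma> (fuchsian m A \<xi>)"
    then obtain c G where cG: "\<forall>i\<in>{1..m}. mat_analytic_on (c i) P \<and> c i ` P \<subseteq> mat ` (- {0}) \<and> invertible (G i)"
      and Y: "\<forall>t\<in>P. \<exists>Y. fundamental_solution_at (\<lambda>x. fuchsian m A \<xi> x t) x0 Y \<and>
        (\<forall>i\<in>{1..m}. continues_along (\<gamma> i) Y (\<lambda>q. Y q ** G i ** c i t))"
      unfolding projectively_isomonodromic_def by (elim conjE exE) (rule that)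
    have c: "mat_analytic_on (c i) P" "c i ` P \<subseteq> mat ` (- {0})" and G: "invertible (G i)"
      if "i \<in> {1..m}" for i
      using cG that by simp_all
    define n where "n = (of_nat CARD('n) :: complex)"
    have n: "n \<noteq> 0"
      by (simp add: n_def)
    \<comment> \<open>This choice makes \<open>B j\<close> the trace-free part of
      \<open>A j\<close>. The scalar term b in the statement is therefore
      \<open>mat (- \<beta> i t)\<close>.\<close>
    define \<beta> where "\<beta> j t = - 1 / n * trace (A j t)" for j t
    define B where "B j t = A j t + mat (\<beta> j t)" for j t
    have \<beta>_an: "sc_analytic_on (\<beta> j) P" if "j \<in> {1..m}" for j
      unfolding \<beta>_def trace_def
      by (intro sc_analytic_on_mult sc_analytic_on_const sc_analytic_on_sum A_an that)
    have \<beta>_sum: "(\<Sum>j\<in>{1..m}. \<beta> j t) = 0" if "Infty \<in> D" "t \<in> P" for t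
    proof -
      have "(\<Sum>j\<in>{1..m}. A j t) = 0"
        using analytic_equation_sum_residues[OF assms(12) assms(3)] that by blast
      then have "(\<Sum>j\<in>{1..m}. A j t $ k $ k) = 0" for k
        by (metis sum_component zero_index)
      then have "(\<Sum>j\<in>{1..m}. trace (A j t)) = 0"
        unfolding trace_def by (subst sum.swap) simp
      then show ?thesis
        unfolding \<beta>_def sum_distrib_left[symmetric] by simp
    qed
    \<comment> \<open>Removing traces residue by residue amounts to removing the trace of the whole
      coefficient; this form yields both analyticity and tracelessness of the new equation.\<close>
    have fB: "fuchsian m B \<xi> x t = fuchsian m A \<xi> x t + mat (- 1 / n * trace (fuchsian m A \<xi> x t))"
      for x t
      by (subst fuchsian_add_scalar[of m B t A \<beta>])
        (simp_all add: B_def \<beta>_def trace_fuchsian sum_distrib_left sum_negf)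
    have trB: "trace (fuchsian m B \<xi> x t) = 0" for x t
    proof -
      have "trace (mat z :: complex^'n^'n) = n * z" for z
        by (simp add: trace_def mat_nth n_def)
      then show ?thesis
        unfolding fB trace_add using n by simp
    qed
    have "\<exists>\<mu>. (\<forall>i\<in>{1..m}. sc_analytic_on (\<mu> i) P \<and> (\<forall>t\<in>P. \<mu> i t \<noteq> 0)) \<and>
      (\<forall>t\<in>P. \<forall>Y. fundamental_solution_at (\<lambda>x. fuchsian m A \<xi> x t) x0 Y \<longrightarrow>
        (\<exists>Z. fundamental_solution_at (\<lambda>x. fuchsian m B \<xi> x t) x0 Z \<and>
          (\<forall>i\<in>{1..m}. \<forall>M. continues_along (\<gamma> i) Y (\<lambda>q. Y q ** M) \<longrightarrow>
            continues_along (\<gamma> i) Z (\<lambda>q. Z q ** (M ** mat (\<mu> i t))))))"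
      (is "\<exists>\<mu>. ?nonzero \<mu> \<and> ?shift \<mu>")
      by (rule scalar_shift[where \<beta> = \<beta>])
        (use assms(3,7) loops \<xi> \<xi>_an \<beta>_an \<beta>_sum B_def in blast)+
    then obtain \<mu> where \<mu>: "?nonzero \<mu>" and \<mu>_shift: "?shift \<mu>"
      by (elim exE conjE) (rule that)
    \<comment> \<open>All diagonal entries of a scalar matrix agree, so an arbitrary index such as
      \<open>undefined\<close> recovers the scalar. The product \<nu> is the scalar by which G is
      multiplied for the new equation.\<close>
    define \<nu> where "\<nu> i t = c i t $ undefined $ undefined * \<mu> i t" for i t
    have c_mat: "c i t = mat (c i t $ undefined $ undefined)" "c i t $ undefined $ undefined \<noteq> 0"
      if i: "i \<in> {1..m}" and t: "t \<in> P" for i t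
    proof -
      obtain z where "c i t = mat z" "z \<noteq> 0"
        using c(2)[OF i] t by blast
      then show "c i t = mat (c i t $ undefined $ undefined)" "c i t $ undefined $ undefined \<noteq> 0"
        by (simp_all add: mat_nth)
    qed
    have Z: "\<exists>Z. fundamental_solution_at (\<lambda>x. fuchsian m B \<xi> x t) x0 Z \<and>
        (\<forall>i\<in>{1..m}. continues_along (\<gamma> i) Z (\<lambda>q. Z q ** (G i ** mat (\<nu> i t))))" if t: "t \<in> P" for t
    proof -
      obtain Y where Y: "fundamental_solution_at (\<lambda>x. fuchsian m A \<xi> x t) x0 Y"
        "\<forall>i\<in>{1..m}. continues_along (\<gamma> i) Y (\<lambda>q. Y q ** (G i ** c i t))"
        using Y t by (auto simp: matrix_mul_assoc)
      obtain Z where Z: "fundamental_solution_at (\<lambda>x. fuchsian m B \<xi> x t) x0 Z"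
        "\<And>i. i \<in> {1..m} \<Longrightarrow> continues_along (\<gamma> i) Z (\<lambda>q. Z q ** (G i ** c i t ** mat (\<mu> i t)))"
        using \<mu>_shift[rule_format, OF t Y(1)] Y(2) by metis
      moreover have "G i ** c i t ** mat (\<mu> i t) = G i ** mat (\<nu> i t)" if "i \<in> {1..m}" for i
        by (subst c_mat(1)[OF that t]) (simp add: \<nu>_def mat_mult_mat flip: matrix_mul_assoc)
      ultimately show ?thesis
        by auto
    qed
    have det1: "det (G i) * \<nu> i t ^ CARD('n) = 1" if i: "i \<in> {1..m}" and t: "t \<in> P" for i t
    proof -
      obtain Z where "fundamental_solution_at (\<lambda>x. fuchsian m B \<xi> x t) x0 Z"
        "continues_along (\<gamma> i) Z (\<lambda>q. Z q ** (G i ** mat (\<nu> i t)))"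
        using Z[OF t] i by blast
      from det_monodromy_eq_1[OF loops[OF i] this(1) trB this(2)] show ?thesis
        by (simp add: det_mul det_mat)
    qed
    have "\<exists>z. z \<noteq> 0 \<and> (\<forall>t\<in>P. \<nu> i t = z)" if i: "i \<in> {1..m}" for i
    \<comment> \<open>For empty P any nonzero constant serves, and 1 is taken at the end. For
      nonempty P the constant is a value of \<nu>, hence nonzero.\<close>
    proof (cases "P = {}")
      case False
      have "sc_analytic_on (\<nu> i) P"
        unfolding \<nu>_def using c(1)[OF i] \<mu> i
        by (intro sc_analytic_on_mult) (auto simp: mat_analytic_on_def)
      then have "continuous_on P (\<nu> i)"
        by (rule sc_analytic_on_imp_continuous_on)
      moreover have "\<nu> i ` P \<subseteq> {z. z ^ CARD('n) = 1 / det (G i)}"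
      proof
        fix z assume "z \<in> \<nu> i ` P"
        then have "det (G i) * z ^ CARD('n) = 1"
          using det1[OF i] by blast
        then show "z \<in> {z. z ^ CARD('n) = 1 / det (G i)}"
          by (auto simp: eq_divide_eq mult.commute)
      qed
      \<comment> \<open>The exponent is positive, so the equation has finitely many roots.\<close>
      then have "finite (\<nu> i ` P)"
        by (rule finite_subset) auto
      ultimately have "\<nu> i constant_on P"
        using continuous_finite_range_constant simply_connected_imp_connected[OF assms(2)] by blast
      then obtain z where "\<forall>t\<in>P. \<nu> i t = z"
        unfolding constant_on_def by blast
      moreover have "z \<noteq> 0"
        using calculation False c_mat(2)[OF i] \<mu> i by (auto simp: \<nu>_def)
      ultimately show ?thesis by blast
    qed (auto intro: exI[of _ 1])
    then obtain z where z: "\<And>i. i \<in> {1..m} \<Longrightarrow> z i \<noteq> 0"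
      "\<And>i t. i \<in> {1..m} \<Longrightarrow> t \<in> P \<Longrightarrow> \<nu> i t = z i"
      by metis
    have "isomonodromic D P x0 m \<gamma> (fuchsian m B \<xi>)"
      unfolding isomonodromic_def
    \<comment> \<open>The constant \<open>z i\<close> is absorbed into the fixed matrix.\<close>
    proof (intro conjI exI[of _ "\<lambda>i. G i ** mat (z i)"] ballI)
      show "analytic_equation D P (fuchsian m B \<xi>)"
        using analytic_equation_add_trace[OF assms(12), of "- 1 / n"] unfolding fB[abs_def] .
      show "invertible (G i ** mat (z i))" if "i \<in> {1..m}" for i
        using G z that by (intro invertible_mult invertible_mat) auto
      show "\<exists>Y. fundamental_solution_at (\<lambda>x. fuchsian m B \<xi> x t) x0 Y \<and>
          (\<forall>i\<in>{1..m}. continues_along (\<gamma> i) Y (\<lambda>q. Y q ** (G i ** mat (z i))))" if "t \<in> P" for t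
        using Z[OF that] z(2)[OF _ that] by auto
    qed
    moreover have "mat_analytic_on (B i) P" if "i \<in> {1..m}" for i
      using A_an[OF that] mat_an[OF \<beta>_an[OF that]] unfolding mat_analytic_on_def B_def
      by (auto intro: sc_analytic_on_add)
    moreover have "mat_analytic_on (\<lambda>t. mat (- \<beta> i t) :: complex^'n^'n) P" if "i \<in> {1..m}" for i
      using sc_analytic_on_diff[OF sc_analytic_on_const[of 0] \<beta>_an[OF that]] by (intro mat_an) simp
    moreover have "A i t = B i t + mat (- \<beta> i t)" for i t
      by (simp add: B_def vec_eq_iff mat_nth)
    ultimately show "\<exists>b B. (\<forall>i\<in>{1..m}. mat_analytic_on (b i) P \<and> b i ` P \<subseteq> range mat \<and> mat_analytic_on (B i) P) \<and>
        (\<forall>i\<in>{1..m}. \<forall>t\<in>P. A i t = B i t + b i t) \<and> isomonodromic D P x0 m \<gamma> (fuchsian m B \<xi>)"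
      by (intro exI[of _ "\<lambda>i t. mat (- \<beta> i t)"] exI[of _ B]) auto
  next

    \<comment> \<open>From an isomonodromic splitting to projective isomonodromy\<close>
    assume "\<exists>b B. (\<forall>i\<in>{1..m}. mat_analytic_on (b i) P \<and> b i ` P \<subseteq> range mat \<and> mat_analytic_on (B i) P) \<and>
        (\<forall>i\<in>{1..m}. \<forall>t\<in>P. A i t = B i t + b i t) \<and> isomonodromic D P x0 m \<gamma> (fuchsian m B \<xi>)"
    then obtain b and B :: "nat \<Rightarrow> complex^'r \<Rightarrow> complex^'n^'n" where
        bB: "\<forall>i\<in>{1..m}. mat_analytic_on (b i) P \<and> b i ` P \<subseteq> range mat \<and> mat_analytic_on (B i) P"
      and AB: "\<forall>i\<in>{1..m}. \<forall>t\<in>P. A i t = B i t + b i t"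
      and B: "isomonodromic D P x0 m \<gamma> (fuchsian m B \<xi>)"
      by (elim exE conjE) (rule that)
    have B_an: "analytic_equation D P (fuchsian m B \<xi>)"
      using B by (simp add: isomonodromic_def)
    have b: "mat_analytic_on (b i) P" "b i ` P \<subseteq> range mat" if "i \<in> {1..m}" for i
      using bB that by simp_all
    \<comment> \<open>The entry at an arbitrary diagonal position determines a scalar
      matrix.\<close>
    define \<beta> where "\<beta> j t = b j t $ undefined $ undefined" for j t
    have b_mat: "b i t = mat (\<beta> i t)" if i: "i \<in> {1..m}" and t: "t \<in> P" for i t
    proof -
      obtain z where "b i t = mat z"
        using b(2)[OF i] t by blast
      then show ?thesis
        by (simp add: \<beta>_def mat_nth)
    qed
    have \<beta>_an: "sc_analytic_on (\<beta> j) P" if "j \<in> {1..m}" for j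
      using b(1)[OF that] unfolding mat_analytic_on_def \<beta>_def by blast
    \<comment> \<open>Both equations are regular at infinity, the second because
      \<open>isomonodromic\<close> includes analyticity; the difference of two vanishing residue
      sums vanishes.\<close>
    have \<beta>_sum: "(\<Sum>j\<in>{1..m}. \<beta> j t) = 0" if "Infty \<in> D" "t \<in> P" for t
    proof -
      have "(\<Sum>j\<in>{1..m}. A j t) = 0" "(\<Sum>j\<in>{1..m}. B j t) = 0"
        using analytic_equation_sum_residues assms(3,12) B_an that by blast+
      then have "(\<Sum>j\<in>{1..m}. b j t) = 0"
        using AB that(2) by (simp add: sum.distrib)
      then show ?thesis
        unfolding \<beta>_def by (metis sum_component zero_index)
    qed
    have AB': "A j t = B j t + mat (\<beta> j t)" if "j \<in> {1..m}" "t \<in> P" for j t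
      using AB b_mat that by simp
    have "\<exists>\<mu>. (\<forall>i\<in>{1..m}. sc_analytic_on (\<mu> i) P \<and> (\<forall>t\<in>P. \<mu> i t \<noteq> 0)) \<and>
      (\<forall>t\<in>P. \<forall>Y. fundamental_solution_at (\<lambda>x. fuchsian m B \<xi> x t) x0 Y \<longrightarrow>
        (\<exists>Z. fundamental_solution_at (\<lambda>x. fuchsian m A \<xi> x t) x0 Z \<and>
          (\<forall>i\<in>{1..m}. \<forall>M. continues_along (\<gamma> i) Y (\<lambda>q. Y q ** M) \<longrightarrow>
            continues_along (\<gamma> i) Z (\<lambda>q. Z q ** (M ** mat (\<mu> i t))))))"
      (is "\<exists>\<mu>. ?nonzero \<mu> \<and> ?shift \<mu>")
      by (rule scalar_shift[where \<beta> = \<beta>])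
        (use assms(3,7) loops \<xi> \<xi>_an \<beta>_an \<beta>_sum AB' in blast)+
    then obtain \<mu> where \<mu>: "?nonzero \<mu>" and \<mu>_shift: "?shift \<mu>"
      by (elim exE conjE) (rule that)
    obtain G where G: "\<forall>i\<in>{1..m}. invertible (G i)"
      "\<forall>t\<in>P. \<exists>Y. fundamental_solution_at (\<lambda>x. fuchsian m B \<xi> x t) x0 Y \<and>
        (\<forall>i\<in>{1..m}. continues_along (\<gamma> i) Y (\<lambda>q. Y q ** G i))"
      using B unfolding isomonodromic_def by (elim exE conjE) (rule that)
    show "projectively_isomonodromic D P x0 m \<gamma> (fuchsian m A \<xi>)"
      unfolding projectively_isomonodromic_def
    \<comment> \<open>The matrices G stay fixed, and the multipliers \<mu> become the scalar
      functions c.\<close>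
    proof (intro conjI exI[of _ "\<lambda>i t. mat (\<mu> i t)"] exI[of _ G] ballI)
      show "analytic_equation D P (fuchsian m A \<xi>)"
        by (rule assms(12))
      show "mat_analytic_on (\<lambda>t. mat (\<mu> i t) :: complex^'n^'n) P"
        "(\<lambda>t. mat (\<mu> i t) :: complex^'n^'n) ` P \<subseteq> mat ` (- {0})" "invertible (G i)"
        if "i \<in> {1..m}" for i
        using \<mu> G(1) that mat_an by auto
      show "\<exists>Y. fundamental_solution_at (\<lambda>x. fuchsian m A \<xi> x t) x0 Y \<and>
          (\<forall>i\<in>{1..m}. continues_along (\<gamma> i) Y (\<lambda>q. Y q ** G i ** mat (\<mu> i t)))" if t: "t \<in> P" for t
        using G(2)[rule_format, OF t] \<mu>_shift[rule_format, OF t] unfolding matrix_mul_assoc by metis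
    qed
  qed
qed

end
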